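(* In the two-sample setting and under the model and Assumptions 1–4 of the context, let $i\ne j\in\{1,2\}$ and $n_1,n_2\ge 4$. Then $E_0$, $E_i$, $E_{ij}$ are unbiased estimators of $\|{\boldsymbol\mu}_1-{\boldsymbol\mu}_2\|^2/p$, $\mathrm{tr}({\boldsymbol\Sigma}_i^2)/p^2$ and $\mathrm{tr}({\boldsymbol\Sigma}_1{\boldsymbol\Sigma}_2)/p^2$ respectively, and, assuming moreover that $\|{\boldsymbol\mu}_1-{\boldsymbol\mu}_2\|^2/p$ is bounded away from $0$, the following bounds hold uniformly in $p$: \[ \mathrm{Var}\Big(\frac{E_0}{\|{\boldsymbol\mu}_1-{\boldsymbol\mu}_2\|^2/p}\Big)=O\Big(\frac1{n_i}+\frac1{n_j}\Big),\qquad \mathrm{Var}\Big(\frac{E_i}{\mathrm{tr}({\boldsymbol\Sigma}_i^2)/p^2}\Big)=O\Big(\frac1{n_i}\Big), \] \[ \mathrm{Var}\Big(\frac{E_{ij}}{\mathrm{tr}({\boldsymbol\Sigma}_i{\boldsymbol\Sigma}_j)/p^2}\Big)=O\Big(\frac1{n_i}+\frac1{n_j}\Big),\qquad \mathrm{Cov}\Big(\frac{E_i}{\mathrm{tr}({\boldsymbol\Sigma}_i^2)/p^2},\frac{E_{ij}}{\mathrm{tr}({\boldsymbol\Sigma}_i{\boldsymbol\Sigma}_j)/p^2}\Big)=O\Big(\frac1{n_i}\Big). \] In particular each ratio converges in probability to $1$ as $n_1,n_2\to\infty$ (with $p$ fixed or $p\to\infty$).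
   Context: Two-sample setting: for $i=1,2$, ${\bf x}_{i1},\dots,{\bf x}_{in_i}$ are i.i.d. random vectors in $\mathbb{R}^p$ with mean ${\boldsymbol\mu}_i$ and positive definite covariance ${\boldsymbol\Sigma}_i$; the two samples are independent. Model: ${\bf x}_{ik}={\boldsymbol\mu}_i+{\boldsymbol\Lambda}_i{\bf y}_{ik}$, where ${\bf y}_{ik}\in\mathbb{R}^p$ has i.i.d. components with mean $0$ and variance $1$, and ${\boldsymbol\Lambda}_i$ is a deterministic $p\times p$ matrix with ${\boldsymbol\Lambda}_i{\boldsymbol\Lambda}_i'={\boldsymbol\Sigma}_i$. All parameters may depend on $p$. Assumption 1: $\mathrm{E}(y_{iks}^4)=\gamma<\infty$. Assumption 2: $\mathrm{tr}({\boldsymbol\Sigma}_i)/p=O(1)$ as $p\to\infty$, $i=1,2$. Assumption 3: ${\boldsymbol\mu}_i'{\boldsymbol\Sigma}_k{\boldsymbol\mu}_j/p=O(1)$ as $p\to\infty$ for all $i,j,k\in\{1,2\}$. Assumption 4: $\mathrm{tr}({\boldsymbol\Sigma}_i^a\odot{\boldsymbol\Sigma}_j^b)/\mathrm{tr}({\boldsymbol\Sigma}_i^a\otimes{\boldsymbol\Sigma}_j^b)\to0$ as $p\to\infty$ for $a,b\in\{1,2,3\}$, $a+b\le4$, $i,j\in\{1,2\}$ ($\odot$ Hadamard product, $\otimes$ Kronecker product). Estimators: $U_{n_i}=\frac{1}{p\,n_i(n_i-1)}\sum_{k\ne r}{\bf x}_{ik}'{\bf x}_{ir}$, $U_{n_1n_2}=\frac{1}{p\,n_1n_2}\sum_{k=1}^{n_1}\sum_{l=1}^{n_2}{\bf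 x}_{1k}'{\bf x}_{2l}$, $E_0=U_{n_1}+U_{n_2}-2U_{n_1n_2}$. With ${\bf D}_{ikr}={\bf x}_{ik}-{\bf x}_{ir}$ ($k\ne r$), $\eta(n_i)=n_i(n_i-1)(n_i-2)(n_i-3)$ and $\eta(n_in_j)=n_in_j(n_i-1)(n_j-1)$: \[ E_i=\frac{1}{4\eta(n_i)p^2}\sum_{(k,r,k',r')}({\bf D}_{ikr}'{\bf D}_{ik'r'})^2,\qquad E_{ij}=\frac{1}{4\eta(n_in_j)p^2}\sum_{k\ne r}\sum_{l\ne s}({\bf D}_{ikr}'{\bf D}_{jls})^2, \] where the first sum is over ordered quadruples of pairwise distinct indices in $\{1,\dots,n_i\}$, and in the second $k\ne r$ range over $\{1,\dots,n_i\}$, $l\ne s$ over $\{1,\dots,n_j\}$. *)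

theory Defs
  imports "HOL-Probability.Probability" "HOL-Library.Landau_Symbols"
begin

text \<open>Conventions. The dimension p varies, so vectors in R^p are functions
nat => real (only indices s < p matter) and p x p matrices are functions
nat => nat => real (only indices < p matter). Samples are labelled 1 and 2;
observations of sample i are indexed 0,...,n_i - 1 (instead of 1,...,n_i).\<close>

definition vinner :: "nat \<Rightarrow> (nat \<Rightarrow> real) \<Rightarrow> (nat \<Rightarrow> real) \<Rightarrow> real" where
  "vinner p u v = (\<Sum>s<p. u s * v s)"

definition mmult :: "nat \<Rightarrow> (nat \<Rightarrow> nat \<Rightarrow> real) \<Rightarrow> (nat \<Rightarrow> nat \<Rightarrow> real) \<Rightarrow> (nat \<Rightarrow> nat \<Rightarrow> real)" where
  "mmult p A B = (\<lambda>s t. \<Sum>u<p. A s u * B u t)"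

definition mtrans :: "(nat \<Rightarrow> nat \<Rightarrow> real) \<Rightarrow> (nat \<Rightarrow> nat \<Rightarrow> real)" where
  "mtrans A = (\<lambda>s t. A t s)"

definition mid :: "nat \<Rightarrow> nat \<Rightarrow> real" where
  "mid = (\<lambda>s t. if s = t then 1 else 0)"

fun mpow :: "nat \<Rightarrow> (nat \<Rightarrow> nat \<Rightarrow> real) \<Rightarrow> nat \<Rightarrow> (nat \<Rightarrow> nat \<Rightarrow> real)" where
  "mpow p A 0 = mid"
| "mpow p A (Suc m) = mmult p A (mpow p A m)"

definition mvec :: "nat \<Rightarrow> (nat \<Rightarrow> nat \<Rightarrow> real) \<Rightarrow> (nat \<Rightarrow> real) \<Rightarrow> (nat \<Rightarrow> real)" where
  "mvec p A v = (\<lambda>s. \<Sum>t<p. A s t * v t)"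

definition mtrace :: "nat \<Rightarrow> (nat \<Rightarrow> nat \<Rightarrow> real) \<Rightarrow> real" where
  "mtrace p A = (\<Sum>s<p. A s s)"

definition hadamard :: "(nat \<Rightarrow> nat \<Rightarrow> real) \<Rightarrow> (nat \<Rightarrow> nat \<Rightarrow> real) \<Rightarrow> (nat \<Rightarrow> nat \<Rightarrow> real)" where
  "hadamard A B = (\<lambda>s t. A s t * B s t)"

text \<open>Kronecker product of two p x p matrices: a (p*p) x (p*p) matrix, where
row index a*p+b (a,b<p) corresponds to the pair (a,b).\<close>
definition kron :: "nat \<Rightarrow> (nat \<Rightarrow> nat \<Rightarrow> real) \<Rightarrow> (nat \<Rightarrow> nat \<Rightarrow> real) \<Rightarrow> (nat \<Rightarrow> nat \<Rightarrow> real)" where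
  "kron p A B = (\<lambda>s t. A (s div p) (t div p) * B (s mod p) (t mod p))"

definition pos_def :: "nat \<Rightarrow> (nat \<Rightarrow> nat \<Rightarrow> real) \<Rightarrow> bool" where
  "pos_def p A \<longleftrightarrow> (\<forall>s<p. \<forall>t<p. A s t = A t s) \<and>
     (\<forall>v. (\<exists>s<p. v s \<noteq> 0) \<longrightarrow> vinner p v (mvec p A v) > 0)"

definition covariance :: "'a measure \<Rightarrow> ('a \<Rightarrow> real) \<Rightarrow> ('a \<Rightarrow> real) \<Rightarrow> real" where
  "covariance M X Y = integral\<^sup>L M (\<lambda>\<omega>. (X \<omega> - integral\<^sup>L M X) * (Y \<omega> - integral\<^sup>L M Y))"

text \<open>Data model.  Lam i p: the matrix Lambda_i in dimension p; mu i p: the mean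
mu_i in dimension p; Y p i k: the standardized vector y_{ik} in dimension p
(a random vector: Y p i k s omega is its s-th component).
x_{ik} = mu_i + Lambda_i y_{ik}.\<close>

definition Sig :: "(nat \<Rightarrow> nat \<Rightarrow> nat \<Rightarrow> nat \<Rightarrow> real) \<Rightarrow> nat \<Rightarrow> nat \<Rightarrow> (nat \<Rightarrow> nat \<Rightarrow> real)" where
  "Sig Lam i p = mmult p (Lam i p) (mtrans (Lam i p))"

definition obs :: "(nat \<Rightarrow> nat \<Rightarrow> nat \<Rightarrow> nat \<Rightarrow> real) \<Rightarrow> (nat \<Rightarrow> nat \<Rightarrow> nat \<Rightarrow> real)
    \<Rightarrow> (nat \<Rightarrow> nat \<Rightarrow> nat \<Rightarrow> nat \<Rightarrow> 'a \<Rightarrow> real) \<Rightarrow> nat \<Rightarrow> nat \<Rightarrow> nat \<Rightarrow> 'a \<Rightarrow> nat \<Rightarrow> real" where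
  "obs Lam mu Y p i k \<omega> = (\<lambda>s. mu i p s + (\<Sum>t<p. Lam i p s t * Y p i k t \<omega>))"

definition ssize :: "nat \<Rightarrow> nat \<Rightarrow> nat \<Rightarrow> nat" where
  "ssize n1 n2 i = (if i = 1 then n1 else n2)"

definition U_one :: "(nat \<Rightarrow> nat \<Rightarrow> nat \<Rightarrow> nat \<Rightarrow> real) \<Rightarrow> (nat \<Rightarrow> nat \<Rightarrow> nat \<Rightarrow> real)
    \<Rightarrow> (nat \<Rightarrow> nat \<Rightarrow> nat \<Rightarrow> nat \<Rightarrow> 'a \<Rightarrow> real) \<Rightarrow> nat \<Rightarrow> nat \<Rightarrow> nat \<Rightarrow> 'a \<Rightarrow> real" where
  "U_one Lam mu Y p i n \<omega> =
     (\<Sum>k<n. \<Sum>r<n. if k \<noteq> r then vinner p (obs Lam mu Y p i k \<omega>) (obs Lam mu Y p i r \<omega>) else 0)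
       / (real p * real n * (real n - 1))"

definition U_two :: "(nat \<Rightarrow> nat \<Rightarrow> nat \<Rightarrow> nat \<Rightarrow> real) \<Rightarrow> (nat \<Rightarrow> nat \<Rightarrow> nat \<Rightarrow> real)
    \<Rightarrow> (nat \<Rightarrow> nat \<Rightarrow> nat \<Rightarrow> nat \<Rightarrow> 'a \<Rightarrow> real) \<Rightarrow> nat \<Rightarrow> nat \<Rightarrow> nat \<Rightarrow> 'a \<Rightarrow> real" where
  "U_two Lam mu Y p n1 n2 \<omega> =
     (\<Sum>k<n1. \<Sum>l<n2. vinner p (obs Lam mu Y p 1 k \<omega>) (obs Lam mu Y p 2 l \<omega>))
       / (real p * real n1 * real n2)"

definition E0 :: "(nat \<Rightarrow> nat \<Rightarrow> nat \<Rightarrow> nat \<Rightarrow> real) \<Rightarrow> (nat \<Rightarrow> nat \<Rightarrow> nat \<Rightarrow> real)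
    \<Rightarrow> (nat \<Rightarrow> nat \<Rightarrow> nat \<Rightarrow> nat \<Rightarrow> 'a \<Rightarrow> real) \<Rightarrow> nat \<Rightarrow> nat \<Rightarrow> nat \<Rightarrow> 'a \<Rightarrow> real" where
  "E0 Lam mu Y p n1 n2 \<omega> = U_one Lam mu Y p 1 n1 \<omega> + U_one Lam mu Y p 2 n2 \<omega> - 2 * U_two Lam mu Y p n1 n2 \<omega>"

definition Dvec :: "(nat \<Rightarrow> nat \<Rightarrow> nat \<Rightarrow> nat \<Rightarrow> real) \<Rightarrow> (nat \<Rightarrow> nat \<Rightarrow> nat \<Rightarrow> real)
    \<Rightarrow> (nat \<Rightarrow> nat \<Rightarrow> nat \<Rightarrow> nat \<Rightarrow> 'a \<Rightarrow> real) \<Rightarrow> nat \<Rightarrow> nat \<Rightarrow> nat \<Rightarrow> nat \<Rightarrow> 'a \<Rightarrow> nat \<Rightarrow> real" where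
  "Dvec Lam mu Y p i k r \<omega> = (\<lambda>s. obs Lam mu Y p i k \<omega> s - obs Lam mu Y p i r \<omega> s)"

definition Eone :: "(nat \<Rightarrow> nat \<Rightarrow> nat \<Rightarrow> nat \<Rightarrow> real) \<Rightarrow> (nat \<Rightarrow> nat \<Rightarrow> nat \<Rightarrow> real)
    \<Rightarrow> (nat \<Rightarrow> nat \<Rightarrow> nat \<Rightarrow> nat \<Rightarrow> 'a \<Rightarrow> real) \<Rightarrow> nat \<Rightarrow> nat \<Rightarrow> nat \<Rightarrow> 'a \<Rightarrow> real" where
  "Eone Lam mu Y p i n \<omega> =
     (\<Sum>k<n. \<Sum>r<n. \<Sum>k'<n. \<Sum>r'<n.
        if distinct [k, r, k', r']
        then (vinner p (Dvec Lam mu Y p i k r \<omega>) (Dvec Lam mu Y p i k' r' \<omega>))\<^sup>2 else 0)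
     / (4 * (real n * (real n - 1) * (real n - 2) * (real n - 3)) * (real p)\<^sup>2)"

definition Etwo :: "(nat \<Rightarrow> nat \<Rightarrow> nat \<Rightarrow> nat \<Rightarrow> real) \<Rightarrow> (nat \<Rightarrow> nat \<Rightarrow> nat \<Rightarrow> real)
    \<Rightarrow> (nat \<Rightarrow> nat \<Rightarrow> nat \<Rightarrow> nat \<Rightarrow> 'a \<Rightarrow> real) \<Rightarrow> nat \<Rightarrow> nat \<Rightarrow> nat \<Rightarrow> nat \<Rightarrow> nat \<Rightarrow> 'a \<Rightarrow> real" where
  "Etwo Lam mu Y p i j ni nj \<omega> =
     (\<Sum>k<ni. \<Sum>r<ni. \<Sum>l<nj. \<Sum>s<nj.
        if k \<noteq> r \<and> l \<noteq> s
        then (vinner p (Dvec Lam mu Y p i k r \<omega>) (Dvec Lam mu Y p j l s \<omega>))\<^sup>2 else 0)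
     / (4 * (real ni * real nj * (real ni - 1) * (real nj - 1)) * (real p)\<^sup>2)"

definition var :: "'a measure \<Rightarrow> ('a \<Rightarrow> real) \<Rightarrow> real" where
  "var M X = integral\<^sup>L M (\<lambda>\<omega>. (X \<omega> - integral\<^sup>L M X)\<^sup>2)"

definition mudist :: "(nat \<Rightarrow> nat \<Rightarrow> nat \<Rightarrow> real) \<Rightarrow> nat \<Rightarrow> real" where
  "mudist mu p = vinner p (\<lambda>s. mu 1 p s - mu 2 p s) (\<lambda>s. mu 1 p s - mu 2 p s) / real p"

definition R0 where
  "R0 Lam mu Y p n1 n2 \<omega> = E0 Lam mu Y p n1 n2 \<omega> / mudist mu p"

definition Rone where
  "Rone Lam mu Y p i n1 n2 \<omega> =
     Eone Lam mu Y p i (ssize n1 n2 i) \<omega> / (mtrace p (mpow p (Sig Lam i p) 2) / (real p)\<^sup>2)"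

definition Rtwo where
  "Rtwo Lam mu Y p i j n1 n2 \<omega> =
     Etwo Lam mu Y p i j (ssize n1 n2 i) (ssize n1 n2 j) \<omega>
       / (mtrace p (mmult p (Sig Lam i p) (Sig Lam j p)) / (real p)\<^sup>2)"

end

theory Submission
  imports Defs
begin

text \<open>
  All three estimators are averages, over index quadruples, of kernels that depend on four
  observations: \<open>E\<^sub>0\<close> is the average of \<open>(x\<^sub>1\<^sub>k - x\<^sub>2\<^sub>l)'(x\<^sub>1\<^sub>r - x\<^sub>2\<^sub>s) / p\<close> over \<open>k \<noteq> r\<close> and
  \<open>l \<noteq> s\<close>. Kernels with disjoint sets of observations are independent, and only a fraction
  \<open>O(1/n\<^sub>i + 1/n\<^sub>j)\<close> of the pairs of quadruples have an observation in common (\<open>O(1/n\<^sub>i)\<close> within sample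
  \<open>i\<close>), so it suffices to bound the variance of a single normalized kernel uniformly in \<open>p\<close>.

  For the trace estimators the kernel is the square of a decoupled bilinear form \<open>Q\<close> in the
  standardized variables. A fourth moment inequality \<open>E Q\<^sup>4 \<le> C (E Q\<^sup>2)\<^sup>2\<close>, with \<open>C\<close> depending only
  on \<open>\<gamma>\<close>, follows by adding the variables one at a time. For \<open>E\<^sub>0\<close> second moments suffice, and they
  are bounded by \<open>\<delta>'(\<Sigma>\<^sub>1 + \<Sigma>\<^sub>2)\<delta> / p\<^sup>2\<close> and \<open>(tr \<Sigma>\<^sub>1 + tr \<Sigma>\<^sub>2)\<^sup>2 / p\<^sup>2\<close>, where \<open>\<delta> = \<mu>\<^sub>1 - \<mu>\<^sub>2\<close>.
\<close>

section \<open>Moments of multilinear forms in independent variables\<close>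

text \<open>Two facts shape the moment inequality: nothing is known about third moments, and the
  dimension may not enter any constant. In \<open>(S + z) ^ 4\<close> the term cubic in the new
  summand is therefore absorbed into its neighbours before expectations are taken. The bound is
  propagated as one on the square root of the fourth moment, so that every new variable adds a
  multiple of \<open>sqrt (E a ^ 4)\<close> and the total stays comparable with the sum that gives
  the second moment. The coefficients \<open>a\<close> may be random as long as the new variables
  are independent of them: a pass with constants treats linear forms, a second pass with linear
  forms as coefficients treats bilinear ones. This is why the two differences in a kernel must not
  share an observation. In \<open>E0\<close>, pairing observations across the samples removes the
  common location, and the lower bound on \<open>mudist\<close> turns absolute bounds into relative
  ones.\<close>

lemma abs_monomial_le:
  fixes x y :: real
  assumes "m + n \<le> 4"
  shows "\<bar>x ^ m * y ^ n\<bar> \<le> 1 + (x ^ 4 + y ^ 4)"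
proof -
  \<comment> \<open>\<open>z\<close> dominates both bases and is at least 1, so the exponents can be
    raised to 4; its fourth power is one of the three summands on the right.\<close>
  define z where "z = max 1 (max \<bar>x\<bar> \<bar>y\<bar>)"
  have z: "1 \<le> z" "\<bar>x\<bar> \<le> z" "\<bar>y\<bar> \<le> z" by (auto simp: z_def)
  have "\<bar>x ^ m * y ^ n\<bar> = \<bar>x\<bar> ^ m * \<bar>y\<bar> ^ n" by (simp add: abs_mult power_abs)
  also have "\<dots> \<le> z ^ m * z ^ n" using z by (intro mult_mono power_mono) auto
  also have "\<dots> \<le> z ^ 4" using z assms by (metis power_add power_increasing)
  also have "\<dots> \<le> 1 + (x ^ 4 + y ^ 4)"
    by (auto simp: z_def max_def)
  finally show ?thesis .
qed

text \<open>The difference of the two sides is \<open>2 * (z * (S - z))\<^sup>2\<close>. The term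
  \<open>4 * S * z ^ 3\<close>, which would bring in an unknown third moment, is traded for even
  powers of \<open>z\<close>; the term linear in \<open>z\<close> stays, because it will have
  expectation zero.\<close>

lemma fourth_power_sum_le:
  fixes S z :: real
  shows "(S + z) ^ 4 \<le> S ^ 4 + 4 * (S ^ 3 * z) + 8 * (S\<^sup>2 * z\<^sup>2) + 3 * z ^ 4"
proof -
  have "0 \<le> 2 * (z * (S - z))\<^sup>2" by simp
  then show ?thesis by (simp add: power2_eq_square power3_eq_cube power4_eq_xxxx algebra_simps)
qed

context prob_space begin

lemma integrable_monomial:
  fixes f g :: "'a \<Rightarrow> real"
  assumes [measurable]: "random_variable borel f" "random_variable borel g"
    and f: "integrable M (\<lambda>\<omega>. f \<omega> ^ 4)" and g: "integrable M (\<lambda>\<omega>. g \<omega> ^ 4)"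
    and mn: "m + n \<le> 4"
  shows "integrable M (\<lambda>\<omega>. f \<omega> ^ m * g \<omega> ^ n)"
proof (rule Bochner_Integration.integrable_bound)
  show "integrable M (\<lambda>\<omega>. 1 + (f \<omega> ^ 4 + g \<omega> ^ 4))" using f g by simp
  show "AE \<omega> in M. norm (f \<omega> ^ m * g \<omega> ^ n) \<le> norm (1 + (f \<omega> ^ 4 + g \<omega> ^ 4))"
    using abs_monomial_le[OF mn] by (auto simp: zero_le_even_power)
qed measurable

lemma integrable_power_le_4:
  fixes f :: "'a \<Rightarrow> real"
  assumes "random_variable borel f" "integrable M (\<lambda>\<omega>. f \<omega> ^ 4)" "m \<le> 4"
  shows "integrable M (\<lambda>\<omega>. f \<omega> ^ m)"
  using integrable_monomial[of f f m 0] assms by simp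

lemma integrable_fourth_add:
  fixes f g :: "'a \<Rightarrow> real"
  assumes [measurable]: "random_variable borel f" "random_variable borel g"
    and f: "integrable M (\<lambda>\<omega>. f \<omega> ^ 4)" and g: "integrable M (\<lambda>\<omega>. g \<omega> ^ 4)"
  shows "integrable M (\<lambda>\<omega>. (f \<omega> + g \<omega>) ^ 4)"
proof -
  have "integrable M (\<lambda>\<omega>. f \<omega> ^ 4 + 4 * (f \<omega> ^ 3 * g \<omega> ^ 1) + 6 * (f \<omega> ^ 2 * g \<omega> ^ 2)
          + 4 * (f \<omega> ^ 1 * g \<omega> ^ 3) + g \<omega> ^ 4)"
    by (intro Bochner_Integration.integrable_add integrable_mult_right integrable_monomial f g) auto
  also have "(\<lambda>\<omega>. f \<omega> ^ 4 + 4 * (f \<omega> ^ 3 * g \<omega> ^ 1) + 6 * (f \<omega> ^ 2 * g \<omega> ^ 2)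
          + 4 * (f \<omega> ^ 1 * g \<omega> ^ 3) + g \<omega> ^ 4) = (\<lambda>\<omega>. (f \<omega> + g \<omega>) ^ 4)"
    by (simp add: fun_eq_iff power2_eq_square power3_eq_cube power4_eq_xxxx algebra_simps)
  finally show ?thesis .
qed

lemma Cauchy_Schwarz_expectation:
  fixes f g :: "'a \<Rightarrow> real"
  assumes fg: "integrable M (\<lambda>\<omega>. f \<omega> * g \<omega>)"
    and f: "integrable M (\<lambda>\<omega>. (f \<omega>)\<^sup>2)" and g: "integrable M (\<lambda>\<omega>. (g \<omega>)\<^sup>2)"
  shows "expectation (\<lambda>\<omega>. f \<omega> * g \<omega>)
           \<le> sqrt (expectation (\<lambda>\<omega>. (f \<omega>)\<^sup>2)) * sqrt (expectation (\<lambda>\<omega>. (g \<omega>)\<^sup>2))"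
proof -
  define A B H where "A = expectation (\<lambda>\<omega>. (f \<omega>)\<^sup>2)" "B = expectation (\<lambda>\<omega>. (g \<omega>)\<^sup>2)"
    "H = expectation (\<lambda>\<omega>. f \<omega> * g \<omega>)"
  have quad: "2 * t * H \<le> t\<^sup>2 * A + B" for t
  proof -
    have "0 \<le> expectation (\<lambda>\<omega>. (t * f \<omega> - g \<omega>)\<^sup>2)" by (rule Bochner_Integration.integral_nonneg) simp
    also have "(\<lambda>\<omega>. (t * f \<omega> - g \<omega>)\<^sup>2) = (\<lambda>\<omega>. t\<^sup>2 * (f \<omega>)\<^sup>2 + (g \<omega>)\<^sup>2 - 2 * t * (f \<omega> * g \<omega>))"
      by (simp add: fun_eq_iff power2_eq_square algebra_simps)
    also have "expectation \<dots> = t\<^sup>2 * A + B - 2 * t * H"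
      using f g fg by (simp add: A_B_H_def)
    finally show ?thesis by simp
  qed
  have "0 \<le> A" "0 \<le> B" by (simp_all add: A_B_H_def)
  have "H\<^sup>2 \<le> A * B"
  proof (cases "A = 0")
    case True
    have "H = 0"
    proof (rule ccontr)
      assume "H \<noteq> 0"
      \<comment> \<open>At this \<open>t\<close> the left side of \<open>quad\<close> is
        \<open>2 * (B + 1)\<close>, while the right side is \<open>B\<close> since
        \<open>A = 0\<close>.\<close>
      then show False using quad[of "(B + 1) / H"] True \<open>0 \<le> B\<close> by simp
    qed
    then show ?thesis using True by simp
  next
    case False
    then have "A > 0" using \<open>0 \<le> A\<close> by simp
    have "2 * (H / A) * H \<le> (H / A)\<^sup>2 * A + B" by (rule quad)
    then show ?thesis using \<open>A > 0\<close> by (simp add: field_simps power2_eq_square)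
  qed
  then have "\<bar>H\<bar> \<le> sqrt (A * B)" by (rule real_le_rsqrt[of "\<bar>H\<bar>", simplified])
  then show ?thesis by (simp add: A_B_H_def real_sqrt_mult)
qed

end

section \<open>Random variables determined by part of an independent family\<close>

text \<open>An explicit form of measurability with respect to the \<sigma>-algebra generated by the
  \<open>X u\<close> with \<open>u \<in> K\<close>. Naming the factor \<open>g\<close> makes closure
  under arithmetic a composition of measurable maps, and reduces independence over disjoint index
  sets to that of restricted tuples.\<close>

definition factors_through :: "('i \<Rightarrow> 'a \<Rightarrow> real) \<Rightarrow> 'i set \<Rightarrow> ('a \<Rightarrow> real) \<Rightarrow> bool" where
  "factors_through X K f \<longleftrightarrow>
     (\<exists>g \<in> borel_measurable (Pi\<^sub>M K (\<lambda>_. borel)). f = (\<lambda>\<omega>. g (\<lambda>u\<in>K. X u \<omega>)))"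

lemma factors_through_const [simp]: "factors_through X K (\<lambda>_. c)"
  unfolding factors_through_def by (rule bexI[of _ "\<lambda>_. c"]) auto

lemma factors_through_component:
  assumes "u \<in> K"
  shows "factors_through X K (X u)"
  unfolding factors_through_def using assms
  by (intro bexI[of _ "\<lambda>x. x u"]) (auto intro: measurable_component_singleton)

lemma factors_through_binary:
  assumes f: "factors_through X K f" and g: "factors_through X K g"
    and h: "(\<lambda>(x, y). h x y) \<in> borel_measurable (borel \<Otimes>\<^sub>M borel)"
  shows "factors_through X K (\<lambda>\<omega>. h (f \<omega>) (g \<omega>))"
proof -
  obtain f' where f': "f' \<in> borel_measurable (Pi\<^sub>M K (\<lambda>_. borel))" "f = (\<lambda>\<omega>. f' (\<lambda>u\<in>K. X u \<omega>))"
    using f unfolding factors_through_def by auto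
  obtain g' where g': "g' \<in> borel_measurable (Pi\<^sub>M K (\<lambda>_. borel))" "g = (\<lambda>\<omega>. g' (\<lambda>u\<in>K. X u \<omega>))"
    using g unfolding factors_through_def by auto
  have "(\<lambda>x. case (f' x, g' x) of (x, y) \<Rightarrow> h x y) \<in> borel_measurable (Pi\<^sub>M K (\<lambda>_. borel))"
    by (rule measurable_compose[OF measurable_Pair[OF f'(1) g'(1)] h])
  then show ?thesis
    unfolding factors_through_def f'(2) g'(2)
    by (intro bexI[of _ "\<lambda>x. h (f' x) (g' x)"]) auto
qed

lemma factors_through_add:
  assumes "factors_through X K f" "factors_through X K g"
  shows "factors_through X K (\<lambda>\<omega>. f \<omega> + g \<omega>)"
  by (rule factors_through_binary[OF assms]) measurable

lemma factors_through_diff: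
  assumes "factors_through X K f" "factors_through X K g"
  shows "factors_through X K (\<lambda>\<omega>. f \<omega> - g \<omega>)"
  by (rule factors_through_binary[OF assms]) measurable

lemma factors_through_mult:
  assumes "factors_through X K f" "factors_through X K g"
  shows "factors_through X K (\<lambda>\<omega>. f \<omega> * g \<omega>)"
  by (rule factors_through_binary[OF assms]) measurable

lemma factors_through_power:
  assumes "factors_through X K f"
  shows "factors_through X K (\<lambda>\<omega>. f \<omega> ^ n)"
  by (induction n) (simp_all add: factors_through_mult assms)

lemma factors_through_sum:
  assumes "\<And>i. i \<in> A \<Longrightarrow> factors_through X K (f i)"
  shows "factors_through X K (\<lambda>\<omega>. \<Sum>i\<in>A. f i \<omega>)"
  using assms by (induction A rule: infinite_finite_induct) (simp_all add: factors_through_add)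

lemma factors_through_mono:
  assumes f: "factors_through X K f" and "K \<subseteq> K'"
  shows "factors_through X K' f"
proof -
  obtain f' where f': "f' \<in> borel_measurable (Pi\<^sub>M K (\<lambda>_. borel))" "f = (\<lambda>\<omega>. f' (\<lambda>u\<in>K. X u \<omega>))"
    using f unfolding factors_through_def by auto
  have "(\<lambda>x. f' (restrict x K)) \<in> borel_measurable (Pi\<^sub>M K' (\<lambda>_. borel))"
    by (rule measurable_compose[OF measurable_restrict_subset[OF assms(2)] f'(1)])
  moreover have "restrict (\<lambda>u\<in>K'. X u \<omega>) K = (\<lambda>u\<in>K. X u \<omega>)" for \<omega>
    using assms(2) by (auto simp: restrict_def fun_eq_iff)
  ultimately show ?thesis
    unfolding factors_through_def f'(2)
    by (intro bexI[of _ "\<lambda>x. f' (restrict x K)"]) auto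
qed

lemmas factors_through_intros =
  factors_through_const factors_through_component factors_through_add factors_through_diff factors_through_mult
  factors_through_power factors_through_sum

section \<open>Fourth moments of sums with random coefficients\<close>

locale standardized_family = prob_space M for M :: "'a measure" +
  fixes X :: "'i \<Rightarrow> 'a \<Rightarrow> real" and I :: "'i set" and \<gamma> :: real
  assumes indep: "indep_vars (\<lambda>_. borel) X I"
    and fourth_integrable: "\<And>u. u \<in> I \<Longrightarrow> integrable M (\<lambda>\<omega>. X u \<omega> ^ 4)"
    and mean: "\<And>u. u \<in> I \<Longrightarrow> expectation (X u) = 0"
    and second_moment: "\<And>u. u \<in> I \<Longrightarrow> expectation (\<lambda>\<omega>. (X u \<omega>)\<^sup>2) = 1"
    and fourth_moment: "\<And>u. u \<in> I \<Longrightarrow> expectation (\<lambda>\<omega>. X u \<omega> ^ 4) = \<gamma>"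
begin

lemma random_variable_X: "u \<in> I \<Longrightarrow> random_variable borel (X u)"
  using indep unfolding indep_vars_def by auto

lemma random_variable_factors_through:
  assumes f: "factors_through X K f" and K: "K \<subseteq> I"
  shows "random_variable borel f"
proof -
  obtain f' where f': "f' \<in> borel_measurable (Pi\<^sub>M K (\<lambda>_. borel))" "f = (\<lambda>\<omega>. f' (\<lambda>u\<in>K. X u \<omega>))"
    using f unfolding factors_through_def by auto
  show ?thesis unfolding f'(2)
    by (rule measurable_compose[OF measurable_restrict f'(1)]) (use K random_variable_X in auto)
qed

lemma indep_var_factors_through:
  assumes f: "factors_through X K f" and g: "factors_through X K' g"
    and K: "K \<inter> K' = {}" "K \<subseteq> I" "K' \<subseteq> I"
  shows "indep_var borel f borel g"
proof -
  obtain f' where f': "f' \<in> borel_measurable (Pi\<^sub>M K (\<lambda>_. borel))" "f = (\<lambda>\<omega>. f' (\<lambda>u\<in>K. X u \<omega>))"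
    using f unfolding factors_through_def by auto
  obtain g' where g': "g' \<in> borel_measurable (Pi\<^sub>M K' (\<lambda>_. borel))" "g = (\<lambda>\<omega>. g' (\<lambda>u\<in>K'. X u \<omega>))"
    using g unfolding factors_through_def by auto
  show ?thesis
    using indep_var_compose[OF indep_var_restrict[OF indep K] f'(1) g'(1)]
    by (simp add: comp_def f'(2) g'(2))
qed

lemma indep_mult:
  assumes "factors_through X K f" "factors_through X K' g"
    and "K \<inter> K' = {}" "K \<subseteq> I" "K' \<subseteq> I"
    and "integrable M f" "integrable M g"
  shows "integrable M (\<lambda>\<omega>. f \<omega> * g \<omega>)"
    and "expectation (\<lambda>\<omega>. f \<omega> * g \<omega>) = expectation f * expectation g"
  using indep_var_integrable[OF indep_var_factors_through[OF assms(1-5)] assms(6,7)]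
    indep_var_lebesgue_integral[OF indep_var_factors_through[OF assms(1-5)] assms(6,7)] by auto

lemma integrable_X_power: "u \<in> I \<Longrightarrow> m \<le> 4 \<Longrightarrow> integrable M (\<lambda>\<omega>. X u \<omega> ^ m)"
  by (rule integrable_power_le_4[OF random_variable_X fourth_integrable])

lemma \<gamma>_nonneg: "u \<in> I \<Longrightarrow> 0 \<le> \<gamma>"
  using fourth_moment[of u] by (metis Bochner_Integration.integral_nonneg zero_le_even_power even_numeral)

text \<open>Induction on \<open>L\<close>. Given a bound \<open>B\<close> for
  \<open>sqrt (E S ^ 4)\<close>, one more summand \<open>X u * a u\<close> leads to \<open>B\<^sup>2
  + 8 * (B * \<alpha>) + 3 * (\<gamma> * \<alpha>\<^sup>2)\<close> with
  \<open>\<alpha> = sqrt (E (a u) ^ 4)\<close>. This is at most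
  \<open>(B + C * \<alpha>)\<^sup>2\<close> as soon as \<open>8 \<le> 2 * C\<close> and
  \<open>3 * \<gamma> \<le> C\<^sup>2\<close>, and \<open>C = 3 * \<gamma> + 4\<close> meets both.
  The coefficients may depend on each other, but only through variables indexed by \<open>R\<close>,
  away from \<open>L\<close>.\<close>

lemma linear_combination_moments:
  assumes L: "finite L" "L \<subseteq> I" and R: "R \<subseteq> I" "L \<inter> R = {}"
    and a: "\<And>u. u \<in> L \<Longrightarrow> factors_through X R (a u)"
      "\<And>u. u \<in> L \<Longrightarrow> integrable M (\<lambda>\<omega>. a u \<omega> ^ 4)"
  shows "integrable M (\<lambda>\<omega>. (\<Sum>u\<in>L. X u \<omega> * a u \<omega>) ^ 4)
    \<and> expectation (\<lambda>\<omega>. (\<Sum>u\<in>L. X u \<omega> * a u \<omega>) ^ 4)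
        \<le> ((3 * \<gamma> + 4) * (\<Sum>u\<in>L. sqrt (expectation (\<lambda>\<omega>. a u \<omega> ^ 4))))\<^sup>2
    \<and> expectation (\<lambda>\<omega>. (\<Sum>u\<in>L. X u \<omega> * a u \<omega>)\<^sup>2) = (\<Sum>u\<in>L. expectation (\<lambda>\<omega>. (a u \<omega>)\<^sup>2))
    \<and> expectation (\<lambda>\<omega>. (\<Sum>u\<in>L. X u \<omega> * a u \<omega>)) = 0"
  using L(1,2) R(2) a
proof (induction L rule: finite_induct)
  case empty
  then show ?case by simp
next
  case (insert u L)
  define S where "S = (\<lambda>\<omega>. \<Sum>v\<in>L. X v \<omega> * a v \<omega>)"
  define C where "C = 3 * \<gamma> + 4"
  define B where "B = C * (\<Sum>v\<in>L. sqrt (expectation (\<lambda>\<omega>. a v \<omega> ^ 4)))"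
  define \<alpha> where "\<alpha> = sqrt (expectation (\<lambda>\<omega>. a u \<omega> ^ 4))"
  have IH: "integrable M (\<lambda>\<omega>. S \<omega> ^ 4)" "expectation (\<lambda>\<omega>. S \<omega> ^ 4) \<le> B\<^sup>2"
    "expectation (\<lambda>\<omega>. (S \<omega>)\<^sup>2) = (\<Sum>u\<in>L. expectation (\<lambda>\<omega>. (a u \<omega>)\<^sup>2))" "expectation S = 0"
    unfolding S_def B_def C_def using insert.IH insert.prems by auto
  have u: "u \<in> I" "u \<notin> L \<union> R" using insert.prems insert.hyps by auto
  have LR: "L \<union> R \<subseteq> I" "{u} \<inter> (L \<union> R) = {}" "{u} \<subseteq> I" using insert.prems R u by auto
  have fS: "factors_through X (L \<union> R) S"
    unfolding S_def
    by (intro factors_through_sum factors_through_mult factors_through_component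
          factors_through_mono[OF insert.prems(3)]) auto
  have fa: "factors_through X (L \<union> R) (a u)"
    by (rule factors_through_mono[OF insert.prems(3)]) auto
  have fX: "factors_through X {u} (X u)" by (rule factors_through_component) simp
  note rv = random_variable_factors_through[OF fS LR(1)] random_variable_factors_through[OF fa LR(1)]
    random_variable_X[OF u(1)]
  have ia: "integrable M (\<lambda>\<omega>. a u \<omega> ^ 4)" using insert.prems by auto
  \<comment> \<open>\<open>u\<close> lies outside \<open>L \<union> R\<close>, so \<open>X u\<close>
    is independent of the pair \<open>S\<close>, \<open>a u\<close>, and these mixed moments
    split.\<close>
  have mono: "integrable M (\<lambda>\<omega>. X u \<omega> ^ k * (S \<omega> ^ m * a u \<omega> ^ n))"
    "expectation (\<lambda>\<omega>. X u \<omega> ^ k * (S \<omega> ^ m * a u \<omega> ^ n))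
       = expectation (\<lambda>\<omega>. X u \<omega> ^ k) * expectation (\<lambda>\<omega>. S \<omega> ^ m * a u \<omega> ^ n)"
    if "k \<le> 4" "m + n \<le> 4" for k m n
    by (rule indep_mult[OF factors_through_power[OF fX]
          factors_through_mult[OF factors_through_power[OF fS] factors_through_power[OF fa]]
          LR(2,3,1) integrable_X_power[OF u(1)] integrable_monomial[OF rv(1,2) IH(1) ia]];
        use that in simp)+
  have Xa: "integrable M (\<lambda>\<omega>. (X u \<omega> * a u \<omega>) ^ 4)"
    using mono(1)[of 4 0 4] by (simp add: power_mult_distrib)
  have int4: "integrable M (\<lambda>\<omega>. (S \<omega> + X u \<omega> * a u \<omega>) ^ 4)"
    by (rule integrable_fourth_add[OF rv(1) borel_measurable_times[OF rv(3,2)] IH(1) Xa])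
  have B0: "0 \<le> B" "0 \<le> \<alpha>" "4 \<le> C" using \<gamma>_nonneg[OF u(1)]
    by (auto simp: B_def C_def \<alpha>_def intro!: mult_nonneg_nonneg sum_nonneg)
  \<comment> \<open>\<open>S\<close> and \<open>a u\<close> may both depend on the variables of
    \<open>R\<close>, so this moment does not split into a product.\<close>
  have CS: "expectation (\<lambda>\<omega>. (S \<omega>)\<^sup>2 * (a u \<omega>)\<^sup>2) \<le> B * \<alpha>"
  proof -
    have "expectation (\<lambda>\<omega>. (S \<omega>)\<^sup>2 * (a u \<omega>)\<^sup>2)
        \<le> sqrt (expectation (\<lambda>\<omega>. ((S \<omega>)\<^sup>2)\<^sup>2)) * sqrt (expectation (\<lambda>\<omega>. ((a u \<omega>)\<^sup>2)\<^sup>2))"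
      by (rule Cauchy_Schwarz_expectation)
        (use IH(1) ia integrable_monomial[OF rv(1,2) IH(1) ia, of 2 2] in \<open>simp_all add: power_mult[symmetric]\<close>)
    also have "\<dots> = sqrt (expectation (\<lambda>\<omega>. S \<omega> ^ 4)) * \<alpha>" by (simp add: \<alpha>_def power_mult[symmetric])
    also have "\<dots> \<le> B * \<alpha>"
      using real_le_lsqrt[OF B0(1) IH(2)] B0 by (intro mult_right_mono) auto
    finally show ?thesis .
  qed
  have "expectation (\<lambda>\<omega>. (S \<omega> + X u \<omega> * a u \<omega>) ^ 4)
      \<le> expectation (\<lambda>\<omega>. S \<omega> ^ 4 + 4 * (X u \<omega> ^ 1 * (S \<omega> ^ 3 * a u \<omega> ^ 1))
           + 8 * (X u \<omega> ^ 2 * (S \<omega> ^ 2 * a u \<omega> ^ 2)) + 3 * (X u \<omega> ^ 4 * (S \<omega> ^ 0 * a u \<omega> ^ 4)))"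
  proof (rule integral_mono[OF int4])
    show "integrable M (\<lambda>\<omega>. S \<omega> ^ 4 + 4 * (X u \<omega> ^ 1 * (S \<omega> ^ 3 * a u \<omega> ^ 1))
           + 8 * (X u \<omega> ^ 2 * (S \<omega> ^ 2 * a u \<omega> ^ 2)) + 3 * (X u \<omega> ^ 4 * (S \<omega> ^ 0 * a u \<omega> ^ 4)))"
      by (intro Bochner_Integration.integrable_add integrable_mult_right mono(1) IH(1)) auto
    show "(S \<omega> + X u \<omega> * a u \<omega>) ^ 4 \<le> S \<omega> ^ 4 + 4 * (X u \<omega> ^ 1 * (S \<omega> ^ 3 * a u \<omega> ^ 1))
           + 8 * (X u \<omega> ^ 2 * (S \<omega> ^ 2 * a u \<omega> ^ 2)) + 3 * (X u \<omega> ^ 4 * (S \<omega> ^ 0 * a u \<omega> ^ 4))" for \<omega>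
      using fourth_power_sum_le[of "S \<omega>" "X u \<omega> * a u \<omega>"]
      by (simp add: power_mult_distrib mult.assoc mult.left_commute)
  qed
  also have "\<dots> = expectation (\<lambda>\<omega>. S \<omega> ^ 4) + 8 * expectation (\<lambda>\<omega>. (S \<omega>)\<^sup>2 * (a u \<omega>)\<^sup>2) + 3 * (\<gamma> * \<alpha>\<^sup>2)"
    using mono[of 1 3 1] mono[of 2 2 2] mono[of 4 0 4] IH(1) mean[OF u(1)] second_moment[OF u(1)] fourth_moment[OF u(1)]
    by (simp add: \<alpha>_def)
  also have "\<dots> \<le> B\<^sup>2 + 8 * (B * \<alpha>) + 3 * (\<gamma> * \<alpha>\<^sup>2)"
    using IH(2) CS by simp
  also have "\<dots> \<le> B\<^sup>2 + 2 * C * (B * \<alpha>) + C\<^sup>2 * \<alpha>\<^sup>2"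
  proof -
    have "8 * (B * \<alpha>) \<le> 2 * C * (B * \<alpha>)" using B0 by (intro mult_right_mono) auto
    moreover have "3 * \<gamma> \<le> C\<^sup>2"
    proof -
      have "3 * \<gamma> \<le> C" by (simp add: C_def)
      also have "C \<le> C\<^sup>2" using B0 by (simp add: power2_eq_square)
      finally show ?thesis .
    qed
    then have "3 * (\<gamma> * \<alpha>\<^sup>2) \<le> C\<^sup>2 * \<alpha>\<^sup>2"
      using mult_right_mono[of "3 * \<gamma>" "C\<^sup>2" "\<alpha>\<^sup>2"] by (simp add: mult.assoc)
    ultimately show ?thesis by linarith
  qed
  also have "\<dots> = (C * (\<Sum>v\<in>insert u L. sqrt (expectation (\<lambda>\<omega>. a v \<omega> ^ 4))))\<^sup>2"
    using insert.hyps by (simp add: B_def \<alpha>_def power2_eq_square algebra_simps)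
  finally have bound: "expectation (\<lambda>\<omega>. (S \<omega> + X u \<omega> * a u \<omega>) ^ 4)
    \<le> (C * (\<Sum>v\<in>insert u L. sqrt (expectation (\<lambda>\<omega>. a v \<omega> ^ 4))))\<^sup>2" .
  have S2: "integrable M (\<lambda>\<omega>. (S \<omega>)\<^sup>2)" "integrable M S"
    using integrable_power_le_4[OF rv(1) IH(1), of 2] integrable_power_le_4[OF rv(1) IH(1), of 1] by auto
  have "(\<lambda>\<omega>. (S \<omega> + X u \<omega> * a u \<omega>)\<^sup>2) = (\<lambda>\<omega>. (S \<omega>)\<^sup>2 + 2 * (X u \<omega> ^ 1 * (S \<omega> ^ 1 * a u \<omega> ^ 1))
      + X u \<omega> ^ 2 * (S \<omega> ^ 0 * a u \<omega> ^ 2))"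
    by (simp add: fun_eq_iff power2_eq_square algebra_simps)
  then have "expectation (\<lambda>\<omega>. (S \<omega> + X u \<omega> * a u \<omega>)\<^sup>2)
      = (\<Sum>v\<in>insert u L. expectation (\<lambda>\<omega>. (a v \<omega>)\<^sup>2))"
    using mono[of 1 1 1] mono[of 2 0 2] mean[OF u(1)] second_moment[OF u(1)] IH(3) S2 insert.hyps
    by simp
  moreover have "expectation (\<lambda>\<omega>. S \<omega> + X u \<omega> * a u \<omega>) = 0"
    using mono[of 1 0 1] mean[OF u(1)] IH(4) S2 by simp
  moreover have "(\<Sum>v\<in>insert u L. X v \<omega> * a v \<omega>) = S \<omega> + X u \<omega> * a u \<omega>" for \<omega>
    using insert.hyps by (simp add: S_def)
  ultimately show ?case using int4 bound unfolding C_def by simp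
qed

end

section \<open>Linear, bilinear and inner product forms\<close>

text \<open>The squared Frobenius norm of the product of \<open>A\<close> transposed with
  \<open>B\<close>, written as the entrywise product of the Gram matrices of the rows. Expanding the
  square and exchanging sums separates \<open>u\<close> from \<open>v\<close>. This is how
  covariance matrices replace their factors.\<close>

lemma sum_square_coefficients_eq:
  fixes A :: "'s \<Rightarrow> 'u \<Rightarrow> real" and B :: "'s \<Rightarrow> 'v \<Rightarrow> real"
  shows "(\<Sum>u\<in>L. \<Sum>v\<in>R. (\<Sum>s\<in>S. A s u * B s v)\<^sup>2)
    = (\<Sum>s\<in>S. \<Sum>t\<in>S. (\<Sum>u\<in>L. A s u * A t u) * (\<Sum>v\<in>R. B s v * B t v))"
proof -
  have "(\<Sum>u\<in>L. \<Sum>v\<in>R. (\<Sum>s\<in>S. A s u * B s v)\<^sup>2)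
      = (\<Sum>u\<in>L. \<Sum>v\<in>R. \<Sum>s\<in>S. \<Sum>t\<in>S. (A s u * A t u) * (B s v * B t v))"
    by (simp add: power2_eq_square sum_product mult_ac)
  also have "\<dots> = (\<Sum>u\<in>L. \<Sum>s\<in>S. \<Sum>v\<in>R. \<Sum>t\<in>S. (A s u * A t u) * (B s v * B t v))"
    by (intro sum.cong refl sum.swap)
  also have "\<dots> = (\<Sum>u\<in>L. \<Sum>s\<in>S. \<Sum>t\<in>S. \<Sum>v\<in>R. (A s u * A t u) * (B s v * B t v))"
    by (intro sum.cong refl sum.swap)
  also have "\<dots> = (\<Sum>s\<in>S. \<Sum>u\<in>L. \<Sum>t\<in>S. \<Sum>v\<in>R. (A s u * A t u) * (B s v * B t v))"
    by (rule sum.swap)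
  also have "\<dots> = (\<Sum>s\<in>S. \<Sum>t\<in>S. \<Sum>u\<in>L. \<Sum>v\<in>R. (A s u * A t u) * (B s v * B t v))"
    by (intro sum.cong refl sum.swap)
  also have "\<dots> = (\<Sum>s\<in>S. \<Sum>t\<in>S. (\<Sum>u\<in>L. A s u * A t u) * (\<Sum>v\<in>R. B s v * B t v))"
    by (simp add: sum_product)
  finally show ?thesis .
qed

context prob_space begin

lemma integrable_mult_square_integrable:
  fixes f g :: "'a \<Rightarrow> real"
  assumes [measurable]: "random_variable borel f" "random_variable borel g"
    and f: "integrable M (\<lambda>\<omega>. (f \<omega>)\<^sup>2)" and g: "integrable M (\<lambda>\<omega>. (g \<omega>)\<^sup>2)"
  shows "integrable M (\<lambda>\<omega>. f \<omega> * g \<omega>)"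
proof (rule Bochner_Integration.integrable_bound)
  show "integrable M (\<lambda>\<omega>. (f \<omega>)\<^sup>2 + (g \<omega>)\<^sup>2)" using f g by simp
  have "\<bar>x * y\<bar> \<le> x\<^sup>2 + y\<^sup>2" for x y :: real
  proof -
    have "2 * (\<bar>x\<bar> * \<bar>y\<bar>) \<le> x\<^sup>2 + y\<^sup>2"
      using sum_squares_bound[of "\<bar>x\<bar>" "\<bar>y\<bar>"] by (simp add: mult.assoc)
    moreover have "0 \<le> \<bar>x\<bar> * \<bar>y\<bar>" by simp
    ultimately show ?thesis unfolding abs_mult by linarith
  qed
  then show "AE \<omega> in M. norm (f \<omega> * g \<omega>) \<le> norm ((f \<omega>)\<^sup>2 + (g \<omega>)\<^sup>2)" by simp
qed measurable

lemma integrable_square_sum: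
  fixes f :: "'j \<Rightarrow> 'a \<Rightarrow> real"
  assumes "\<And>j. j \<in> A \<Longrightarrow> random_variable borel (f j)"
    and "\<And>j. j \<in> A \<Longrightarrow> integrable M (\<lambda>\<omega>. (f j \<omega>)\<^sup>2)"
  shows "integrable M (\<lambda>\<omega>. (\<Sum>j\<in>A. f j \<omega>)\<^sup>2)"
  unfolding power2_eq_square sum_product
  using assms by (intro Bochner_Integration.integrable_sum integrable_mult_square_integrable) auto

end

context standardized_family begin

text \<open>For constant coefficients \<open>sqrt (c v ^ 4) = (c v)\<^sup>2\<close>, so the fourth
  moment is compared directly with the square of the variance.\<close>

lemma linear_form_moments:
  fixes c :: "'i \<Rightarrow> real"
  assumes R: "finite R" "R \<subseteq> I"
  defines "f \<equiv> \<lambda>\<omega>. \<Sum>v\<in>R. c v * X v \<omega>"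
  shows "integrable M (\<lambda>\<omega>. f \<omega> ^ 4)"
    and "expectation (\<lambda>\<omega>. f \<omega> ^ 4) \<le> ((3 * \<gamma> + 4) * (\<Sum>v\<in>R. (c v)\<^sup>2))\<^sup>2"
    and "expectation (\<lambda>\<omega>. (f \<omega>)\<^sup>2) = (\<Sum>v\<in>R. (c v)\<^sup>2)"
    and "expectation f = 0"
    and "factors_through X R f"
proof -
  have "sqrt (c v ^ 4) = (c v)\<^sup>2" for v
    by (rule real_sqrt_unique) (simp_all add: power_mult[symmetric])
  then show "integrable M (\<lambda>\<omega>. f \<omega> ^ 4)"
    and "expectation (\<lambda>\<omega>. f \<omega> ^ 4) \<le> ((3 * \<gamma> + 4) * (\<Sum>v\<in>R. (c v)\<^sup>2))\<^sup>2"
    and "expectation (\<lambda>\<omega>. (f \<omega>)\<^sup>2) = (\<Sum>v\<in>R. (c v)\<^sup>2)"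
    and "expectation f = 0"
    using linear_combination_moments[OF R, of "{}" "\<lambda>v _. c v"]
    by (simp_all add: f_def prob_space mult.commute)
  show "factors_through X R f"
    unfolding f_def by (intro factors_through_intros)
qed

text \<open>The form is a sum over \<open>L\<close> whose coefficients are linear forms in the
  variables of \<open>R\<close>, disjoint from \<open>L\<close>. Each of the two passes contributes
  one factor \<open>3 * \<gamma> + 4\<close>.\<close>

lemma bilinear_form_moments:
  fixes c :: "'i \<Rightarrow> 'i \<Rightarrow> real"
  assumes L: "finite L" "L \<subseteq> I" and R: "finite R" "R \<subseteq> I" and LR: "L \<inter> R = {}"
  defines "Q \<equiv> \<lambda>\<omega>. \<Sum>u\<in>L. X u \<omega> * (\<Sum>v\<in>R. c u v * X v \<omega>)"
  shows "integrable M (\<lambda>\<omega>. Q \<omega> ^ 4)"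
    and "expectation (\<lambda>\<omega>. Q \<omega> ^ 4) \<le> ((3 * \<gamma> + 4)\<^sup>2 * (\<Sum>u\<in>L. \<Sum>v\<in>R. (c u v)\<^sup>2))\<^sup>2"
    and "expectation (\<lambda>\<omega>. (Q \<omega>)\<^sup>2) = (\<Sum>u\<in>L. \<Sum>v\<in>R. (c u v)\<^sup>2)"
    and "expectation Q = 0"
    and "factors_through X (L \<union> R) Q"
proof -
  note a = linear_form_moments[OF R]
  note m = linear_combination_moments[OF L R(2) LR a(5,1)]
  show "integrable M (\<lambda>\<omega>. Q \<omega> ^ 4)" "expectation Q = 0"
    and "expectation (\<lambda>\<omega>. (Q \<omega>)\<^sup>2) = (\<Sum>u\<in>L. \<Sum>v\<in>R. (c u v)\<^sup>2)"
    using m[of c] by (simp_all add: Q_def a(3))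
  have "sqrt (expectation (\<lambda>\<omega>. (\<Sum>v\<in>R. c u v * X v \<omega>) ^ 4))
      \<le> (3 * \<gamma> + 4) * (\<Sum>v\<in>R. (c u v)\<^sup>2)" if "u \<in> L" for u
    using a(2)[of "c u"] \<gamma>_nonneg[of u] that L(2)
    by (intro real_le_lsqrt mult_nonneg_nonneg sum_nonneg) auto
  then have le: "(\<Sum>u\<in>L. sqrt (expectation (\<lambda>\<omega>. (\<Sum>v\<in>R. c u v * X v \<omega>) ^ 4)))
      \<le> (3 * \<gamma> + 4) * (\<Sum>u\<in>L. \<Sum>v\<in>R. (c u v)\<^sup>2)"
    unfolding sum_distrib_left[of "3 * \<gamma> + 4" _ L] by (rule sum_mono)
  show "expectation (\<lambda>\<omega>. Q \<omega> ^ 4) \<le> ((3 * \<gamma> + 4)\<^sup>2 * (\<Sum>u\<in>L. \<Sum>v\<in>R. (c u v)\<^sup>2))\<^sup>2"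
  \<comment> \<open>An empty \<open>L\<close> offers no index from which
    \<open>0 \<le> \<gamma>\<close> could be derived, but then \<open>Q\<close> vanishes.\<close>
  proof (cases "L = {}")
    case True
    then show ?thesis by (simp add: Q_def)
  next
    case False
    then have "0 \<le> \<gamma>" using \<gamma>_nonneg L by auto
    have "expectation (\<lambda>\<omega>. Q \<omega> ^ 4)
        \<le> ((3 * \<gamma> + 4) * (\<Sum>u\<in>L. sqrt (expectation (\<lambda>\<omega>. (\<Sum>v\<in>R. c u v * X v \<omega>) ^ 4))))\<^sup>2"
      using m[of c] by (simp add: Q_def)
    also have "\<dots> \<le> ((3 * \<gamma> + 4) * ((3 * \<gamma> + 4) * (\<Sum>u\<in>L. \<Sum>v\<in>R. (c u v)\<^sup>2)))\<^sup>2"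
      using le \<open>0 \<le> \<gamma>\<close> by (intro power_mono mult_left_mono mult_nonneg_nonneg sum_nonneg) auto
    finally show ?thesis by (simp add: power2_eq_square mult.assoc)
  qed
  show "factors_through X (L \<union> R) Q"
    unfolding Q_def by (intro factors_through_intros) auto
qed

text \<open>Exchanging sums gives a bilinear form with coefficients
  \<open>\<Sum>s\<in>S. A s u * B s v\<close>. Writing its second moment as \<open>N\<close>
  expresses it by Gram matrices, which in the model are covariance matrices.\<close>

lemma inner_product_moments:
  fixes A B :: "'s \<Rightarrow> 'i \<Rightarrow> real" and S :: "'s set"
  assumes L: "finite L" "L \<subseteq> I" and R: "finite R" "R \<subseteq> I" and LR: "L \<inter> R = {}"
  defines "Q \<equiv> \<lambda>\<omega>. \<Sum>s\<in>S. (\<Sum>u\<in>L. A s u * X u \<omega>) * (\<Sum>v\<in>R. B s v * X v \<omega>)"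
    and "N \<equiv> (\<Sum>s\<in>S. \<Sum>t\<in>S. (\<Sum>u\<in>L. A s u * A t u) * (\<Sum>v\<in>R. B s v * B t v))"
  shows "integrable M (\<lambda>\<omega>. Q \<omega> ^ 4)"
    and "expectation (\<lambda>\<omega>. Q \<omega> ^ 4) \<le> ((3 * \<gamma> + 4)\<^sup>2 * N)\<^sup>2"
    and "expectation (\<lambda>\<omega>. (Q \<omega>)\<^sup>2) = N"
    and "expectation Q = 0"
    and "factors_through X (L \<union> R) Q"
proof -
  have Q: "Q = (\<lambda>\<omega>. \<Sum>u\<in>L. X u \<omega> * (\<Sum>v\<in>R. (\<Sum>s\<in>S. A s u * B s v) * X v \<omega>))"
  proof
    fix \<omega>
    have "Q \<omega> = (\<Sum>s\<in>S. \<Sum>u\<in>L. \<Sum>v\<in>R. A s u * B s v * X u \<omega> * X v \<omega>)"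
      unfolding Q_def sum_product by (simp add: mult_ac)
    also have "\<dots> = (\<Sum>u\<in>L. \<Sum>s\<in>S. \<Sum>v\<in>R. A s u * B s v * X u \<omega> * X v \<omega>)"
      by (rule sum.swap)
    also have "\<dots> = (\<Sum>u\<in>L. \<Sum>v\<in>R. \<Sum>s\<in>S. A s u * B s v * X u \<omega> * X v \<omega>)"
      by (intro sum.cong refl sum.swap)
    also have "\<dots> = (\<Sum>u\<in>L. X u \<omega> * (\<Sum>v\<in>R. (\<Sum>s\<in>S. A s u * B s v) * X v \<omega>))"
      by (simp add: sum_distrib_left sum_distrib_right mult_ac)
    finally show "Q \<omega> = (\<Sum>u\<in>L. X u \<omega> * (\<Sum>v\<in>R. (\<Sum>s\<in>S. A s u * B s v) * X v \<omega>))" .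
  qed
  show "integrable M (\<lambda>\<omega>. Q \<omega> ^ 4)"
    and "expectation (\<lambda>\<omega>. Q \<omega> ^ 4) \<le> ((3 * \<gamma> + 4)\<^sup>2 * N)\<^sup>2"
    and "expectation (\<lambda>\<omega>. (Q \<omega>)\<^sup>2) = N"
    and "expectation Q = 0"
    and "factors_through X (L \<union> R) Q"
    unfolding Q N_def sum_square_coefficients_eq[symmetric]
    using bilinear_form_moments[OF L R LR, of "\<lambda>u v. \<Sum>s\<in>S. A s u * B s v"] by simp_all
qed

section \<open>Covariances of averages of kernels\<close>

lemma average_square_integrable:
  fixes f :: "'j \<Rightarrow> 'a \<Rightarrow> real"
  assumes A: "finite A" "A \<noteq> {}"
    and f: "\<And>J. J \<in> A \<Longrightarrow> factors_through X (K J) (f J)" "\<And>J. J \<in> A \<Longrightarrow> K J \<subseteq> I"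
      "\<And>J. J \<in> A \<Longrightarrow> integrable M (\<lambda>\<omega>. (f J \<omega>)\<^sup>2)"
      "\<And>J. J \<in> A \<Longrightarrow> expectation (f J) = m"
  defines "F \<equiv> \<lambda>\<omega>. (\<Sum>J\<in>A. f J \<omega>) / real (card A)"
  shows "random_variable borel F" and "integrable M (\<lambda>\<omega>. (F \<omega>)\<^sup>2)"
    and "integrable M F" and "expectation F = m"
proof -
  have rv: "random_variable borel (f J)" if "J \<in> A" for J
    using random_variable_factors_through f(1,2) that by blast
  have int: "integrable M (f J)" if "J \<in> A" for J
    using square_integrable_imp_integrable rv f(3) that by blast
  show "random_variable borel F"
    unfolding F_def using rv by (intro borel_measurable_divide borel_measurable_sum) auto
  show "integrable M (\<lambda>\<omega>. (F \<omega>)\<^sup>2)"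
    unfolding F_def power_divide using integrable_square_sum[of A f] rv f(3) by simp
  show "integrable M F" unfolding F_def using int by auto
  have "expectation F = (\<Sum>J\<in>A. expectation (f J)) / real (card A)"
    unfolding F_def using int by (simp add: Bochner_Integration.integral_sum)
  also have "\<dots> = m" using A f(4) by simp
  finally show "expectation F = m" .
qed

text \<open>Expanding both averages gives one covariance per pair of kernels. Pairs with disjoint
  index sets contribute zero by independence; each remaining one is at most \<open>v\<close> by
  \<open>\<bar>x * y\<bar> \<le> (x\<^sup>2 + y\<^sup>2) / 2\<close>. Two families \<open>f\<close>
  and \<open>g\<close> are allowed so that variances and the mixed covariance come from one
  estimate.\<close>

lemma abs_covariance_average_le:
  assumes A: "finite A" "A \<noteq> {}" and B: "finite B" "B \<noteq> {}"
    and f: "\<And>J. J \<in> A \<Longrightarrow> factors_through X (K J) (f J)" "\<And>J. J \<in> A \<Longrightarrow> K J \<subseteq> I"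
      "\<And>J. J \<in> A \<Longrightarrow> integrable M (\<lambda>\<omega>. (f J \<omega>)\<^sup>2)"
      "\<And>J. J \<in> A \<Longrightarrow> expectation (f J) = m"
      "\<And>J. J \<in> A \<Longrightarrow> expectation (\<lambda>\<omega>. (f J \<omega> - m)\<^sup>2) \<le> v"
    and g: "\<And>J. J \<in> B \<Longrightarrow> factors_through X (K' J) (g J)" "\<And>J. J \<in> B \<Longrightarrow> K' J \<subseteq> I"
      "\<And>J. J \<in> B \<Longrightarrow> integrable M (\<lambda>\<omega>. (g J \<omega>)\<^sup>2)"
      "\<And>J. J \<in> B \<Longrightarrow> expectation (g J) = m'"
      "\<And>J. J \<in> B \<Longrightarrow> expectation (\<lambda>\<omega>. (g J \<omega> - m')\<^sup>2) \<le> v"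
    and meet: "real (card {(J, J') \<in> A \<times> B. K J \<inter> K' J' \<noteq> {}}) \<le> \<epsilon> * (real (card A) * real (card B))"
  shows "\<bar>covariance M (\<lambda>\<omega>. (\<Sum>J\<in>A. f J \<omega>) / real (card A)) (\<lambda>\<omega>. (\<Sum>J\<in>B. g J \<omega>) / real (card B))\<bar>
           \<le> v * \<epsilon>"
proof -
  define a b where "a = real (card A)" "b = real (card B)"
  have ab: "a > 0" "b > 0" using A B by (auto simp: a_b_def card_gt_0_iff)
  define f' where "f' = (\<lambda>J \<omega>. f J \<omega> - m)"
  define g' where "g' = (\<lambda>J \<omega>. g J \<omega> - m')"
  define c where "c = (\<lambda>(J, J'). expectation (\<lambda>\<omega>. f' J \<omega> * g' J' \<omega>))"
  have rf: "random_variable borel (f J)" if "J \<in> A" for J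
    using random_variable_factors_through f(1,2) that by blast
  have rg: "random_variable borel (g J)" if "J \<in> B" for J
    using random_variable_factors_through g(1,2) that by blast
  have intf: "integrable M (f J)" if "J \<in> A" for J
    using square_integrable_imp_integrable rf f(3) that by blast
  have intg: "integrable M (g J)" if "J \<in> B" for J
    using square_integrable_imp_integrable rg g(3) that by blast
  have f'_2: "integrable M (\<lambda>\<omega>. (f' J \<omega>)\<^sup>2)" if "J \<in> A" for J
    unfolding f'_def power2_diff using f(3) intf that by simp
  have g'_2: "integrable M (\<lambda>\<omega>. (g' J \<omega>)\<^sup>2)" if "J \<in> B" for J
    unfolding g'_def power2_diff using g(3) intg that by simp
  have prod: "integrable M (\<lambda>\<omega>. f' J \<omega> * g' J' \<omega>)" if "J \<in> A" "J' \<in> B" for J J'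
    using f'_2 g'_2 rf rg that
    by (intro integrable_mult_square_integrable) (auto simp: f'_def g'_def)
  have zero: "c (J, J') = 0" if "J \<in> A" "J' \<in> B" "K J \<inter> K' J' = {}" for J J'
  proof -
    have "factors_through X (K J) (f' J)" "factors_through X (K' J') (g' J')"
      unfolding f'_def g'_def using f(1) g(1) that by (auto intro: factors_through_intros)
    moreover have "integrable M (f' J)" "integrable M (g' J')" "expectation (f' J) = 0"
      using intf intg f(4) that by (simp_all add: f'_def g'_def prob_space)
    ultimately show ?thesis
      using indep_mult(2)[of "K J" "f' J" "K' J'" "g' J'"] f(2) g(2) that by (simp add: c_def)
  qed
  have le: "\<bar>c (J, J')\<bar> \<le> v" if "J \<in> A" "J' \<in> B" for J J'
  proof -
    have "\<bar>c (J, J')\<bar> \<le> expectation (\<lambda>\<omega>. \<bar>f' J \<omega> * g' J' \<omega>\<bar>)"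
      unfolding c_def by (simp add: integral_abs_bound)
    also have "\<dots> \<le> expectation (\<lambda>\<omega>. ((f' J \<omega>)\<^sup>2 + (g' J' \<omega>)\<^sup>2) / 2)"
    proof (rule integral_mono)
      show "integrable M (\<lambda>\<omega>. \<bar>f' J \<omega> * g' J' \<omega>\<bar>)" using prod[OF that] by simp
      show "integrable M (\<lambda>\<omega>. ((f' J \<omega>)\<^sup>2 + (g' J' \<omega>)\<^sup>2) / 2)" using f'_2 g'_2 that by simp
      show "\<bar>f' J \<omega> * g' J' \<omega>\<bar> \<le> ((f' J \<omega>)\<^sup>2 + (g' J' \<omega>)\<^sup>2) / 2" for \<omega>
        using sum_squares_bound[of "\<bar>f' J \<omega>\<bar>" "\<bar>g' J' \<omega>\<bar>"] by (simp add: abs_mult)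
    qed
    also have "\<dots> = (expectation (\<lambda>\<omega>. (f' J \<omega>)\<^sup>2) + expectation (\<lambda>\<omega>. (g' J' \<omega>)\<^sup>2)) / 2"
      using f'_2 g'_2 that by simp
    also have "\<dots> \<le> v"
      using f(5)[OF that(1)] g(5)[OF that(2)] by (simp add: f'_def g'_def)
    finally show ?thesis .
  qed
  \<comment> \<open>Neither \<open>A\<close> nor \<open>B\<close> is empty, so \<open>v\<close>
    bounds the absolute value of some \<open>c (J, J')\<close>; its sign is used when
    \<open>meet\<close> is multiplied by \<open>v\<close>.\<close>
  obtain J0 J0' where J0: "J0 \<in> A" "J0' \<in> B" using A B by auto
  have "0 \<le> v" using le[OF J0] by linarith
  have "covariance M (\<lambda>\<omega>. (\<Sum>J\<in>A. f J \<omega>) / a) (\<lambda>\<omega>. (\<Sum>J\<in>B. g J \<omega>) / b)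
      = expectation (\<lambda>\<omega>. ((\<Sum>J\<in>A. f J \<omega>) / a - m) * ((\<Sum>J\<in>B. g J \<omega>) / b - m'))"
    unfolding covariance_def a_b_def
    using average_square_integrable(4)[OF A f(1-4)] average_square_integrable(4)[OF B g(1-4)] by simp
  also have "(\<lambda>\<omega>. ((\<Sum>J\<in>A. f J \<omega>) / a - m) * ((\<Sum>J\<in>B. g J \<omega>) / b - m'))
      = (\<lambda>\<omega>. (\<Sum>J\<in>A. \<Sum>J'\<in>B. f' J \<omega> * g' J' \<omega>) / (a * b))"
  proof
    fix \<omega>
    have "(\<Sum>J\<in>A. f J \<omega>) / a - m = (\<Sum>J\<in>A. f' J \<omega>) / a"
      "(\<Sum>J\<in>B. g J \<omega>) / b - m' = (\<Sum>J\<in>B. g' J \<omega>) / b"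
      using ab by (simp_all add: f'_def g'_def sum_subtractf a_b_def diff_divide_distrib)
    then show "((\<Sum>J\<in>A. f J \<omega>) / a - m) * ((\<Sum>J\<in>B. g J \<omega>) / b - m')
        = (\<Sum>J\<in>A. \<Sum>J'\<in>B. f' J \<omega> * g' J' \<omega>) / (a * b)"
      by (simp add: sum_product)
  qed
  also have "expectation \<dots> = (\<Sum>J\<in>A. \<Sum>J'\<in>B. c (J, J')) / (a * b)"
    using prod by (simp add: Bochner_Integration.integral_sum c_def)
  also have "\<dots> = (\<Sum>z\<in>A \<times> B. c z) / (a * b)"
    by (simp add: sum.cartesian_product)
  also have "(\<Sum>z\<in>A \<times> B. c z) = (\<Sum>z\<in>{(J, J') \<in> A \<times> B. K J \<inter> K' J' \<noteq> {}}. c z)"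
    using A B zero by (intro sum.mono_neutral_right) auto
  finally have cov: "\<bar>covariance M (\<lambda>\<omega>. (\<Sum>J\<in>A. f J \<omega>) / a) (\<lambda>\<omega>. (\<Sum>J\<in>B. g J \<omega>) / b)\<bar>
      = \<bar>\<Sum>z\<in>{(J, J') \<in> A \<times> B. K J \<inter> K' J' \<noteq> {}}. c z\<bar> / (a * b)"
    using ab by (simp add: abs_mult)
  have "\<bar>\<Sum>z\<in>{(J, J') \<in> A \<times> B. K J \<inter> K' J' \<noteq> {}}. c z\<bar>
      \<le> (\<Sum>z\<in>{(J, J') \<in> A \<times> B. K J \<inter> K' J' \<noteq> {}}. v)"
    using le by (intro order_trans[OF sum_abs] sum_mono) auto
  also have "\<dots> \<le> v * (\<epsilon> * (a * b))"
    using mult_left_mono[OF meet \<open>0 \<le> v\<close>] by (simp add: a_b_def mult_ac)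
  finally have "\<bar>\<Sum>z\<in>{(J, J') \<in> A \<times> B. K J \<inter> K' J' \<noteq> {}}. c z\<bar> / (a * b) \<le> v * \<epsilon>"
    using ab by (simp add: pos_divide_le_eq mult_ac)
  then show ?thesis using cov unfolding a_b_def by simp
qed

end

section \<open>Counting quadruples with a common observation\<close>

text \<open>The predicate stays abstract so that quadruples within one sample and pairs of pairs
  from two samples share the summation and counting lemmas. The first two indices belong to the
  first sample, the last two to the second.\<close>

definition quads :: "nat \<Rightarrow> nat \<Rightarrow> (nat \<Rightarrow> nat \<Rightarrow> nat \<Rightarrow> nat \<Rightarrow> bool) \<Rightarrow> (nat \<times> nat \<times> nat \<times> nat) set" where
  "quads n m P = {(k, r, l, s). k < n \<and> r < n \<and> l < m \<and> s < m \<and> P k r l s}"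

abbreviation "distinct_quads n \<equiv> quads n n (\<lambda>k r l s. distinct [k, r, l, s])"

abbreviation "paired_quads n m \<equiv> quads n m (\<lambda>k r l s. k \<noteq> r \<and> l \<noteq> s)"

text \<open>Observations carry their sample label: equal indices in different samples are different
  observations, while for \<open>i = j\<close> all four indices refer to one sample.\<close>

definition observations :: "nat \<Rightarrow> nat \<Rightarrow> nat \<times> nat \<times> nat \<times> nat \<Rightarrow> (nat \<times> nat) set" where
  "observations i j = (\<lambda>(k, r, l, s). {(i, k), (i, r), (j, l), (j, s)})"

lemma quads_subset: "quads n m P \<subseteq> {..<n} \<times> {..<n} \<times> {..<m} \<times> {..<m}"
  by (auto simp: quads_def)

lemma finite_quads [simp]: "finite (quads n m P)"
  by (rule finite_subset[OF quads_subset]) auto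

lemma sum_quads:
  fixes F :: "nat \<Rightarrow> nat \<Rightarrow> nat \<Rightarrow> nat \<Rightarrow> real"
  shows "(\<Sum>k<n. \<Sum>r<n. \<Sum>l<m. \<Sum>s<m. if P k r l s then F k r l s else 0)
    = (\<Sum>(k, r, l, s)\<in>quads n m P. F k r l s)"
proof -
  have "(\<Sum>k<n. \<Sum>r<n. \<Sum>l<m. \<Sum>s<m. if P k r l s then F k r l s else 0)
    = (\<Sum>(k, r, l, s)\<in>{..<n} \<times> {..<n} \<times> {..<m} \<times> {..<m}. if P k r l s then F k r l s else 0)"
    by (simp add: sum.cartesian_product)
  also have "\<dots> = (\<Sum>(k, r, l, s)\<in>quads n m P. F k r l s)"
    by (intro sum.mono_neutral_cong_right) (auto simp: quads_def split: if_splits)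
  finally show ?thesis .
qed

lemma card_distinct_quads:
  assumes "4 \<le> n"
  shows "real (card (distinct_quads n)) = real n * (real n - 1) * (real n - 2) * (real n - 3)"
proof -
  have "distinct_quads n = (SIGMA k:{..<n}. SIGMA r:{..<n} - {k}. SIGMA l:{..<n} - {k, r}. {..<n} - {k, r, l})"
    by (auto simp: quads_def)
  also have "card \<dots> = (\<Sum>k<n. \<Sum>r\<in>{..<n} - {k}. \<Sum>l\<in>{..<n} - {k, r}. card ({..<n} - {k, r, l}))"
    by (simp add: card_SigmaI)
  also have "\<dots> = (\<Sum>k<n. \<Sum>r\<in>{..<n} - {k}. \<Sum>l\<in>{..<n} - {k, r}. n - 3)"
    by (intro sum.cong refl) (subst card_Diff_subset; auto)
  also have "\<dots> = (\<Sum>k<n. \<Sum>r\<in>{..<n} - {k}. (n - 2) * (n - 3))"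
  proof (intro sum.cong refl)
    fix k r assume "k \<in> {..<n}" "r \<in> {..<n} - {k}"
    then have "card ({..<n} - {k, r}) = n - 2" by (subst card_Diff_subset) auto
    then show "(\<Sum>l\<in>{..<n} - {k, r}. n - 3) = (n - 2) * (n - 3)" by simp
  qed
  also have "\<dots> = n * ((n - 1) * ((n - 2) * (n - 3)))" by simp
  finally show ?thesis using assms by (simp add: of_nat_diff mult.assoc)
qed

lemma card_paired_quads:
  assumes "4 \<le> n" "4 \<le> m"
  shows "real (card (paired_quads n m)) = real n * real m * (real n - 1) * (real m - 1)"
proof -
  have "paired_quads n m = (SIGMA k:{..<n}. SIGMA r:{..<n} - {k}. SIGMA l:{..<m}. {..<m} - {l})"
    by (auto simp: quads_def)
  also have "card \<dots> = n * ((n - 1) * (m * (m - 1)))"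
    by (simp add: card_SigmaI)
  finally show ?thesis using assms by (simp add: of_nat_diff mult_ac)
qed

lemma distinct_quads_nonempty: "4 \<le> n \<Longrightarrow> distinct_quads n \<noteq> {}"
proof -
  assume "4 \<le> n"
  then have "(0, 1, 2, 3) \<in> distinct_quads n" by (simp add: quads_def)
  then show ?thesis by blast
qed

lemma paired_quads_nonempty: "4 \<le> n \<Longrightarrow> 4 \<le> m \<Longrightarrow> paired_quads n m \<noteq> {}"
proof -
  assume "4 \<le> n" "4 \<le> m"
  then have "(0, 1, 0, 1) \<in> paired_quads n m" by (simp add: quads_def)
  then show ?thesis by blast
qed

lemma card_observations_le: "card (observations i j J) \<le> 4"
  by (cases J) (simp add: observations_def card_insert_if)

text \<open>Fixing either of the two positions of the first sample to \<open>x\<close> leaves at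
  most \<open>n * m * m\<close> choices for the other three.\<close>

lemma card_quads_first_le:
  "card {J \<in> quads n m P. x = fst J \<or> x = fst (snd J)} \<le> 2 * (n * m * m)"
proof -
  have "{J \<in> quads n m P. x = fst J \<or> x = fst (snd J)}
      \<subseteq> {x} \<times> {..<n} \<times> {..<m} \<times> {..<m} \<union> {..<n} \<times> {x} \<times> {..<m} \<times> {..<m}"
    by (auto simp: quads_def)
  from card_mono[OF _ this] show ?thesis
    by (rule order_trans[OF _ order_trans[OF card_Un_le]]) (auto simp: card_cartesian_product)
qed

lemma card_quads_last_le:
  "card {J \<in> quads n m P. x = fst (snd (snd J)) \<or> x = snd (snd (snd J))} \<le> 2 * (n * n * m)"
proof -
  have "{J \<in> quads n m P. x = fst (snd (snd J)) \<or> x = snd (snd (snd J))}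
      \<subseteq> {..<n} \<times> {..<n} \<times> {x} \<times> {..<m} \<union> {..<n} \<times> {..<n} \<times> {..<m} \<times> {x}"
    by (auto simp: quads_def)
  from card_mono[OF _ this] show ?thesis
    by (rule order_trans[OF _ order_trans[OF card_Un_le]]) (auto simp: card_cartesian_product)
qed

text \<open>The constant 43 rounds up \<open>4 n\<^sup>4 / (n (n - 1) (n - 2) (n - 3))\<close> at its maximum \<open>n = 4\<close>.\<close>

lemma card_distinct_quads_containing_le:
  assumes n: "4 \<le> n"
  shows "real (card {J \<in> distinct_quads n. x \<in> observations i i J})
           \<le> 43 / real n * real (card (distinct_quads n))"
proof -
  have "{J \<in> distinct_quads n. x \<in> observations i i J}
      \<subseteq> {J \<in> distinct_quads n. snd x = fst J \<or> snd x = fst (snd J)}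
       \<union> {J \<in> distinct_quads n. snd x = fst (snd (snd J)) \<or> snd x = snd (snd (snd J))}"
    by (auto simp: observations_def)
  from card_mono[OF _ this]
  have "card {J \<in> distinct_quads n. x \<in> observations i i J} \<le> 2 * (n * n * n) + 2 * (n * n * n)"
    using card_quads_first_le[of n n "\<lambda>k r l s. distinct [k, r, l, s]" "snd x"]
      card_quads_last_le[of n n "\<lambda>k r l s. distinct [k, r, l, s]" "snd x"]
      card_Un_le[of "{J \<in> distinct_quads n. snd x = fst J \<or> snd x = fst (snd J)}"
        "{J \<in> distinct_quads n. snd x = fst (snd (snd J)) \<or> snd x = snd (snd (snd J))}"]
    by (simp del: distinct.simps)
  then have "real (card {J \<in> distinct_quads n. x \<in> observations i i J}) \<le> 4 * (real n * real n * real n)"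
    by (metis (mono_tags, lifting) mult_2 numeral_Bit0 distrib_right of_nat_le_iff of_nat_mult of_nat_numeral)
  also have "\<dots> \<le> 43 / real n * real (card (distinct_quads n))"
  proof -
    have n': "real n \<ge> 4" using n by simp
    \<comment> \<open>For \<open>n \<ge> 4\<close> the factors \<open>n - 1\<close>,
      \<open>n - 2\<close>, \<open>n - 3\<close> are at least \<open>3 / 4\<close>,
      \<open>1 / 2\<close>, \<open>1 / 4\<close> of \<open>n\<close>, with equality at 4; moreover
      \<open>43 * 3 / 32 \<ge> 4\<close>.\<close>
    have "4 * (real n * real n * real n) \<le> 43 * ((real n * (3 / 4)) * (real n * (1 / 2)) * (real n * (1 / 4)))"
      by (simp add: mult_nonneg_nonneg)
    also have "\<dots> \<le> 43 * ((real n - 1) * (real n - 2) * (real n - 3))"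
      using n' by (intro mult_left_mono mult_mono mult_nonneg_nonneg) auto
    also have "\<dots> = 43 / real n * real (card (distinct_quads n))"
      unfolding card_distinct_quads[OF n] using n' by (simp add: field_simps)
    finally show ?thesis .
  qed
  finally show ?thesis .
qed

text \<open>As \<open>i \<noteq> j\<close>, an observation can occur only in the half of a quadruple
  that belongs to its sample, which leaves two positions. Since \<open>n \<le> 2 * (n - 1)\<close>,
  and likewise for \<open>m\<close>, a factor 8 would do; 43 is kept so that all counts have the
  same constant.\<close>

lemma card_paired_quads_containing_le:
  assumes n: "4 \<le> n" and m: "4 \<le> m" and ij: "i \<noteq> j"
  shows "real (card {J \<in> paired_quads n m. (i, x) \<in> observations i j J})
           \<le> 43 / real n * real (card (paired_quads n m))"
    and "real (card {J \<in> paired_quads n m. (j, x) \<in> observations i j J})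
           \<le> 43 / real m * real (card (paired_quads n m))"
proof -
  have n': "real n \<ge> 4" "real m \<ge> 4" using n m by simp_all
  have sq: "real n * real n * (real m * real m) \<le> 2 * (2 * (real n * (real n - 1) * (real m * (real m - 1))))"
  proof -
    have "real n * real n * (real m * real m)
        \<le> (real n * (2 * (real n - 1))) * (real m * (2 * (real m - 1)))"
      using n' by (intro mult_mono mult_nonneg_nonneg) auto
    also have "\<dots> = 2 * (2 * (real n * (real n - 1) * (real m * (real m - 1))))"
      by (simp only: mult_ac)
    finally show ?thesis .
  qed
  have "0 \<le> real n * (real n - 1) * (real m * (real m - 1))" using n' by simp
  then have card: "2 * (real n * real n * (real m * real m)) \<le> 43 * real (card (paired_quads n m))"
  proof -
    have "real (card (paired_quads n m)) = real n * (real n - 1) * (real m * (real m - 1))"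
      by (simp only: card_paired_quads[OF n m] mult_ac)
    then show ?thesis using \<open>0 \<le> real n * (real n - 1) * (real m * (real m - 1))\<close> sq by linarith
  qed
  have "{J \<in> paired_quads n m. (i, x) \<in> observations i j J}
      = {J \<in> paired_quads n m. x = fst J \<or> x = fst (snd J)}"
    using ij by (auto simp: observations_def)
  then have "real (card {J \<in> paired_quads n m. (i, x) \<in> observations i j J}) \<le> real (2 * (n * m * m))"
    by (simp only: of_nat_le_iff card_quads_first_le)
  also have "\<dots> \<le> 43 / real n * real (card (paired_quads n m))"
  proof -
    have "real n * real (2 * (n * m * m)) = 2 * (real n * real n * (real m * real m))"
      by simp
    with card have "real n * real (2 * (n * m * m)) \<le> 43 * real (card (paired_quads n m))" by (simp only:)
    then show ?thesis using n' by (simp add: field_simps)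
  qed
  finally show "real (card {J \<in> paired_quads n m. (i, x) \<in> observations i j J})
           \<le> 43 / real n * real (card (paired_quads n m))" .
  have "{J \<in> paired_quads n m. (j, x) \<in> observations i j J}
      = {J \<in> paired_quads n m. x = fst (snd (snd J)) \<or> x = snd (snd (snd J))}"
    using ij by (auto simp: observations_def)
  then have "real (card {J \<in> paired_quads n m. (j, x) \<in> observations i j J}) \<le> real (2 * (n * n * m))"
    by (simp only: of_nat_le_iff card_quads_last_le)
  also have "\<dots> \<le> 43 / real m * real (card (paired_quads n m))"
  proof -
    have "real m * real (2 * (n * n * m)) = 2 * (real n * real n * (real m * real m))"
      by simp
    with card have "real m * real (2 * (n * n * m)) \<le> 43 * real (card (paired_quads n m))" by (simp only:)
    then show ?thesis using n' by (simp add: field_simps)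
  qed
  finally show "real (card {J \<in> paired_quads n m. (j, x) \<in> observations i j J})
           \<le> 43 / real m * real (card (paired_quads n m))" .
qed

text \<open>Union bound: \<open>J'\<close> meets \<open>J\<close> only through one of the at most
  \<open>c\<close> elements of \<open>S J\<close>, and each of these occurs in at most a fraction
  \<open>\<epsilon>\<close> of \<open>B\<close>.\<close>

lemma card_meeting_pairs_le:
  fixes \<epsilon> :: real
  assumes A: "finite A" and B: "finite B"
    and S: "\<And>J. J \<in> A \<Longrightarrow> finite (S J) \<and> card (S J) \<le> c"
    and T: "\<And>J x. J \<in> A \<Longrightarrow> x \<in> S J \<Longrightarrow> real (card {J' \<in> B. x \<in> T J'}) \<le> \<epsilon> * real (card B)"
    and \<epsilon>: "0 \<le> \<epsilon>"
  shows "real (card {(J, J') \<in> A \<times> B. S J \<inter> T J' \<noteq> {}}) \<le> real c * \<epsilon> * (real (card A) * real (card B))"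
proof -
  have fin: "finite (S J)" if "J \<in> A" for J using S that by blast
  have "{(J, J') \<in> A \<times> B. S J \<inter> T J' \<noteq> {}} = (SIGMA J:A. \<Union>x\<in>S J. {J' \<in> B. x \<in> T J'})"
    by auto
  then have "card {(J, J') \<in> A \<times> B. S J \<inter> T J' \<noteq> {}} = (\<Sum>J\<in>A. card (\<Union>x\<in>S J. {J' \<in> B. x \<in> T J'}))"
    using A B fin by (simp add: card_SigmaI)
  also have "\<dots> \<le> (\<Sum>J\<in>A. \<Sum>x\<in>S J. card {J' \<in> B. x \<in> T J'})"
    by (intro sum_mono card_UN_le fin)
  finally have "real (card {(J, J') \<in> A \<times> B. S J \<inter> T J' \<noteq> {}})
      \<le> (\<Sum>J\<in>A. \<Sum>x\<in>S J. real (card {J' \<in> B. x \<in> T J'}))"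
    by (simp flip: of_nat_sum)
  also have "\<dots> \<le> (\<Sum>J\<in>A. \<Sum>x\<in>S J. \<epsilon> * real (card B))"
    using T by (intro sum_mono) auto
  also have "\<dots> \<le> (\<Sum>J\<in>A. real c * (\<epsilon> * real (card B)))"
    using S \<epsilon> by (intro sum_mono) (auto intro!: mult_right_mono)
  also have "\<dots> = real c * \<epsilon> * (real (card A) * real (card B))" by simp
  finally show ?thesis .
qed

text \<open>Each \<open>G k r\<close> is counted once per pair \<open>l \<noteq> s\<close>, each
  \<open>K l s\<close> once per pair \<open>k \<noteq> r\<close>. An entry of \<open>H\<close>
  recurs for every choice of one further index in each sample, and the two mixed terms have the same
  total. This identifies an average of products of differences with a combination of
  U-statistics.\<close>

lemma sum_paired_quads_differences:
  fixes G H K :: "nat \<Rightarrow> nat \<Rightarrow> real"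
  assumes nm: "4 \<le> n" "4 \<le> m"
  shows "(\<Sum>(k, r, l, s)\<in>paired_quads n m. G k r - H k s - H r l + K l s)
    = real m * (real m - 1) * (\<Sum>k<n. \<Sum>r<n. if k \<noteq> r then G k r else 0)
      + real n * (real n - 1) * (\<Sum>l<m. \<Sum>s<m. if l \<noteq> s then K l s else 0)
      - 2 * ((real n - 1) * (real m - 1) * (\<Sum>k<n. \<Sum>l<m. H k l))"
proof -
  \<comment> \<open>As a factor instead of a condition, the indicator lets the fourfold sums split;
    its row and column sums over \<open>N\<close> indices are all \<open>N - 1\<close>.\<close>
  define d :: "nat \<Rightarrow> nat \<Rightarrow> real" where "d = (\<lambda>k r. if k \<noteq> r then 1 else 0)"
  have d1: "(\<Sum>r<N. d k r) = real N - 1" if "k < N" for k N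
  proof -
    have "(\<Sum>r<N. d k r) = (\<Sum>r<N. 1 - (if k = r then 1 else 0))" by (intro sum.cong) (auto simp: d_def)
    also have "\<dots> = real N - 1" using that by (simp add: sum_subtractf)
    finally show ?thesis .
  qed
  have d2: "(\<Sum>k<N. d k r) = real N - 1" if "r < N" for r N
    using d1[OF that] by (simp add: d_def eq_commute)
  have G: "(\<Sum>k<n. \<Sum>r<n. \<Sum>l<m. \<Sum>s<m. d k r * d l s * G k r)
      = real m * (real m - 1) * (\<Sum>k<n. \<Sum>r<n. d k r * G k r)"
  proof -
    have "(\<Sum>l<m. \<Sum>s<m. d k r * d l s * G k r) = real m * (real m - 1) * (d k r * G k r)" for k r
    proof -
      have "(\<Sum>l<m. \<Sum>s<m. d k r * d l s * G k r) = (\<Sum>l<m. (d k r * G k r) * (\<Sum>s<m. d l s))"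
        by (simp add: sum_distrib_left mult_ac)
      also have "\<dots> = real m * (real m - 1) * (d k r * G k r)" by (simp add: d1)
      finally show ?thesis .
    qed
    then show ?thesis by (simp add: sum_distrib_left)
  qed
  have K: "(\<Sum>k<n. \<Sum>r<n. \<Sum>l<m. \<Sum>s<m. d k r * d l s * K l s)
      = real n * (real n - 1) * (\<Sum>l<m. \<Sum>s<m. d l s * K l s)"
  proof -
    have "(\<Sum>k<n. \<Sum>r<n. \<Sum>l<m. \<Sum>s<m. d k r * d l s * K l s)
        = (\<Sum>k<n. (\<Sum>r<n. d k r) * (\<Sum>l<m. \<Sum>s<m. d l s * K l s))"
      by (intro sum.cong refl, subst sum_distrib_right, intro sum.cong refl)
        (simp add: sum_distrib_left mult.assoc)
    also have "\<dots> = real n * (real n - 1) * (\<Sum>l<m. \<Sum>s<m. d l s * K l s)" by (simp add: d1)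
    finally show ?thesis .
  qed
  have H1: "(\<Sum>k<n. \<Sum>r<n. \<Sum>l<m. \<Sum>s<m. d k r * d l s * H k s)
      = (real n - 1) * (real m - 1) * (\<Sum>k<n. \<Sum>l<m. H k l)"
  proof -
    have "(\<Sum>k<n. \<Sum>r<n. \<Sum>l<m. \<Sum>s<m. d k r * d l s * H k s)
        = (\<Sum>k<n. \<Sum>r<n. \<Sum>s<m. \<Sum>l<m. d k r * d l s * H k s)"
      by (intro sum.cong refl sum.swap)
    also have "\<dots> = (\<Sum>k<n. (\<Sum>r<n. d k r) * (\<Sum>s<m. (\<Sum>l<m. d l s) * H k s))"
      by (intro sum.cong refl, subst sum_distrib_right, intro sum.cong refl)
        (simp add: sum_distrib_left sum_distrib_right mult_ac)
    also have "\<dots> = (real n - 1) * (real m - 1) * (\<Sum>k<n. \<Sum>l<m. H k l)"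
      by (simp add: d1 d2 sum_distrib_left[symmetric] mult.assoc)
    finally show ?thesis .
  qed
  have H2: "(\<Sum>k<n. \<Sum>r<n. \<Sum>l<m. \<Sum>s<m. d k r * d l s * H r l)
      = (real n - 1) * (real m - 1) * (\<Sum>k<n. \<Sum>l<m. H k l)"
  proof -
    have "(\<Sum>k<n. \<Sum>r<n. \<Sum>l<m. \<Sum>s<m. d k r * d l s * H r l)
        = (\<Sum>r<n. \<Sum>k<n. \<Sum>l<m. \<Sum>s<m. d k r * d l s * H r l)"
      by (rule sum.swap)
    also have "\<dots> = (\<Sum>r<n. (\<Sum>k<n. d k r) * (\<Sum>l<m. (\<Sum>s<m. d l s) * H r l))"
      by (intro sum.cong refl, subst sum_distrib_right, intro sum.cong refl)
        (simp add: sum_distrib_left sum_distrib_right mult_ac)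
    also have "\<dots> = (real n - 1) * (real m - 1) * (\<Sum>k<n. \<Sum>l<m. H k l)"
      by (simp add: d1 d2 sum_distrib_left[symmetric] mult.assoc)
    finally show ?thesis .
  qed
  have "(\<Sum>(k, r, l, s)\<in>paired_quads n m. G k r - H k s - H r l + K l s)
      = (\<Sum>k<n. \<Sum>r<n. \<Sum>l<m. \<Sum>s<m. if k \<noteq> r \<and> l \<noteq> s then G k r - H k s - H r l + K l s else 0)"
    by (rule sum_quads[symmetric])
  also have "\<dots> = (\<Sum>k<n. \<Sum>r<n. \<Sum>l<m. \<Sum>s<m. d k r * d l s * G k r - d k r * d l s * H k s
      - d k r * d l s * H r l + d k r * d l s * K l s)"
    by (intro sum.cong refl) (auto simp: d_def)
  also have "\<dots> = real m * (real m - 1) * (\<Sum>k<n. \<Sum>r<n. d k r * G k r)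
      + real n * (real n - 1) * (\<Sum>l<m. \<Sum>s<m. d l s * K l s)
      - 2 * ((real n - 1) * (real m - 1) * (\<Sum>k<n. \<Sum>l<m. H k l))"
    unfolding sum.distrib sum_subtractf G K H1 H2 by simp
  also have "(\<Sum>k<n. \<Sum>r<n. d k r * G k r) = (\<Sum>k<n. \<Sum>r<n. if k \<noteq> r then G k r else 0)"
    by (intro sum.cong refl) (auto simp: d_def)
  also have "(\<Sum>l<m. \<Sum>s<m. d l s * K l s) = (\<Sum>l<m. \<Sum>s<m. if l \<noteq> s then K l s else 0)"
    by (intro sum.cong refl) (auto simp: d_def)
  finally show ?thesis .
qed

section \<open>The two-sample model\<close>

lemma mtrace_mmult_Sig:
  "mtrace p (mmult p (Sig Lam i p) (Sig Lam j p)) = (\<Sum>s<p. \<Sum>t<p. Sig Lam i p s t * Sig Lam j p s t)"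
  by (simp add: mtrace_def mmult_def Sig_def mtrans_def mult.commute)

lemma mtrace_mpow_2_Sig:
  "mtrace p (mpow p (Sig Lam i p) 2) = mtrace p (mmult p (Sig Lam i p) (Sig Lam i p))"
proof -
  \<comment> \<open>\<open>mpow\<close> ends in the identity \<open>mid\<close>, and multiplying by
    it restores \<open>A\<close> only in columns below \<open>p\<close>; the others become
    zero.\<close>
  have "mmult p A mid s t = A s t" if "t < p" for A s t
    using that by (simp add: mmult_def mid_def if_distrib[of "(*) _"] cong: if_cong)
  moreover have "mmult p A (mmult p A mid) s s = (\<Sum>u<p. A s u * mmult p A mid u s)" for A s
    by (simp only: mmult_def[of p A "mmult p A mid"])
  ultimately show ?thesis
    by (simp add: numeral_2_eq_2 mtrace_def) (simp add: mmult_def[of p _ "Sig Lam i p"])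
qed

lemma sum_square_inner_columns:
  "(\<Sum>s<p. \<Sum>t<p. Sig Lam i p s t * Sig Lam j p s t)
     = (\<Sum>u<p. \<Sum>v<p. (\<Sum>s<p. Lam i p s u * Lam j p s v)\<^sup>2)"
  unfolding sum_square_coefficients_eq by (simp add: Sig_def mmult_def mtrans_def)

lemma pos_def_diagonal:
  assumes "pos_def p A" "s < p"
  shows "0 < A s s"
proof -
  have "0 < vinner p (mid s) (mvec p A (mid s))"
    using assms unfolding pos_def_def by (auto simp: mid_def)
  also have "\<dots> = A s s"
    using assms(2) by (simp add: vinner_def mvec_def mid_def if_distrib[of "\<lambda>x. x * _"]
      if_distrib[of "(*) _"] cong: if_cong)
  finally show ?thesis .
qed

text \<open>The trace is the squared Frobenius norm of \<open>\<Lambda>\<^sub>i\<^sup>T \<Lambda>\<^sub>j\<close>; if it vanished, then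
  \<open>\<Sigma>\<^sub>i\<close> would annihilate the columns of \<open>\<Sigma>\<^sub>j\<close>.\<close>

lemma mtrace_mmult_Sig_pos:
  assumes p: "1 \<le> p" and i: "pos_def p (Sig Lam i p)" and j: "pos_def p (Sig Lam j p)"
  shows "0 < mtrace p (mmult p (Sig Lam i p) (Sig Lam j p))"
proof (rule ccontr)
  assume "\<not> ?thesis"
  moreover have "0 \<le> mtrace p (mmult p (Sig Lam i p) (Sig Lam j p))"
    unfolding mtrace_mmult_Sig sum_square_inner_columns by (intro sum_nonneg) simp
  ultimately have "(\<Sum>u<p. \<Sum>v<p. (\<Sum>s<p. Lam i p s u * Lam j p s v)\<^sup>2) = 0"
    unfolding mtrace_mmult_Sig sum_square_inner_columns by simp
  then have "\<forall>u<p. (\<Sum>v<p. (\<Sum>s<p. Lam i p s u * Lam j p s v)\<^sup>2) = 0"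
    by (subst (asm) sum_nonneg_eq_0_iff) (auto intro: sum_nonneg)
  then have zero: "(\<Sum>s<p. Lam i p s u * Lam j p s v) = 0" if "u < p" "v < p" for u v
    using that by (subst (asm) sum_nonneg_eq_0_iff) auto
  \<comment> \<open>Column 0 exists since \<open>1 \<le> p\<close>. Its entry 0 is a diagonal entry
    of a positive definite matrix, so \<open>w\<close> is a nonzero vector annihilated by
    \<open>Sig Lam i p\<close>.\<close>
  define w where "w = (\<lambda>s. Sig Lam j p s 0)"
  have "mvec p (Sig Lam i p) w r = 0" for r
  proof -
    have "mvec p (Sig Lam i p) w r
        = (\<Sum>s<p. \<Sum>u<p. \<Sum>v<p. Lam i p r u * Lam j p 0 v * (Lam i p s u * Lam j p s v))"
      by (simp add: mvec_def w_def Sig_def mmult_def mtrans_def sum_product mult_ac)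
    also have "\<dots> = (\<Sum>u<p. \<Sum>s<p. \<Sum>v<p. Lam i p r u * Lam j p 0 v * (Lam i p s u * Lam j p s v))"
      by (rule sum.swap)
    also have "\<dots> = (\<Sum>u<p. \<Sum>v<p. \<Sum>s<p. Lam i p r u * Lam j p 0 v * (Lam i p s u * Lam j p s v))"
      by (intro sum.cong refl sum.swap)
    also have "\<dots> = 0"
      by (simp add: sum_distrib_left[symmetric] zero)
    finally show ?thesis .
  qed
  then have "vinner p w (mvec p (Sig Lam i p) w) = 0" by (simp add: vinner_def)
  then have "w 0 = 0" using i p unfolding pos_def_def by force
  moreover have "0 < w 0" unfolding w_def using pos_def_diagonal[OF j, of 0] p by simp
  ultimately show False by simp
qed

section \<open>Differences of observations as linear forms\<close>

text \<open>The scalar variables behind a set of observations. The independent family is indexed by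
  such triples, so disjoint sets of observations become disjoint index sets.\<close>

definition cells :: "nat \<Rightarrow> (nat \<times> nat) set \<Rightarrow> (nat \<times> nat \<times> nat) set" where
  "cells p S = {(a, k, s). (a, k) \<in> S \<and> s < p}"

text \<open>Coefficients of component \<open>s\<close> of the centred difference between observation
  \<open>b\<close> and another one. Every observation other than \<open>b\<close> receives the sign
  -1; the function is evaluated only on the cells of two observations.\<close>

definition contrast :: "(nat \<Rightarrow> nat \<Rightarrow> nat \<Rightarrow> nat \<Rightarrow> real) \<Rightarrow> nat \<Rightarrow> nat \<times> nat \<Rightarrow> nat \<Rightarrow> nat \<times> nat \<times> nat \<Rightarrow> real" where
  "contrast Lam p b s = (\<lambda>(a, k, t). (if (a, k) = b then 1 else - 1) * Lam a p s t)"

lemma cells_eq_image: "cells p S = (\<lambda>(b, t). (fst b, snd b, t)) ` (S \<times> {..<p})"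
  by (force simp: cells_def image_iff)

lemma finite_cells: "finite S \<Longrightarrow> finite (cells p S)"
  by (simp add: cells_eq_image)

lemma cells_Un: "cells p (S \<union> T) = cells p S \<union> cells p T"
  by (auto simp: cells_def)

lemma cells_disjoint: "S \<inter> T = {} \<Longrightarrow> cells p S \<inter> cells p T = {}"
  by (auto simp: cells_def)

lemma sum_cells_pair:
  assumes "(i, k) \<noteq> (j, l)"
  shows "(\<Sum>u\<in>cells p {(i, k), (j, l)}. F u) = (\<Sum>t<p. F (i, k, t)) + (\<Sum>t<p. F (j, l, t) :: real)"
proof -
  have "(\<Sum>u\<in>cells p {(i, k), (j, l)}. F u)
      = (\<Sum>(b, t)\<in>{(i, k), (j, l)} \<times> {..<p}. F (fst b, snd b, t))"
    unfolding cells_eq_image by (subst sum.reindex) (auto simp: inj_on_def case_prod_unfold)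
  also have "\<dots> = (\<Sum>b\<in>{(i, k), (j, l)}. \<Sum>t<p. F (fst b, snd b, t))"
    by (rule sum.cartesian_product[symmetric])
  also have "\<dots> = (\<Sum>t<p. F (i, k, t)) + (\<Sum>t<p. F (j, l, t))"
    using assms by (subst sum.insert) auto
  finally show ?thesis .
qed

lemma obs_diff_eq:
  assumes "(i, k) \<noteq> (j, l)"
  shows "obs Lam mu Y p i k \<omega> s - obs Lam mu Y p j l \<omega> s = (mu i p s - mu j p s)
    + (\<Sum>u\<in>cells p {(i, k), (j, l)}. contrast Lam p (i, k) s u * (case u of (a, k, t) \<Rightarrow> Y p a k t) \<omega>)"
  unfolding sum_cells_pair[OF assms] using assms
  by (auto simp: obs_def contrast_def sum_negf)

text \<open>The signs cancel in the product and the two observations contribute separately; for two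
  observations of one sample the result is twice their covariance matrix.\<close>

lemma contrast_covariance:
  assumes "(i, k) \<noteq> (j, l)"
  shows "(\<Sum>u\<in>cells p {(i, k), (j, l)}. contrast Lam p (i, k) s u * contrast Lam p (i, k) t u)
    = Sig Lam i p s t + Sig Lam j p s t"
  unfolding sum_cells_pair[OF assms] using assms
  by (auto simp: contrast_def Sig_def mmult_def mtrans_def)

section \<open>The model in a fixed dimension and the trace kernels\<close>

text \<open>Only one dimension is considered at a time; uniformity in \<open>p\<close> will be
  visible as the absence of \<open>p\<close> from the final bounds.\<close>

locale two_sample_model =
  standardized_family M "\<lambda>(a, k, s). Y p a k s" "{(a, k, s). a \<in> {1, 2::nat} \<and> s < p}" \<gamma>
  for M :: "'a measure" and Y :: "nat \<Rightarrow> nat \<Rightarrow> nat \<Rightarrow> nat \<Rightarrow> 'a \<Rightarrow> real" and p :: nat and \<gamma> :: real +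
  fixes Lam :: "nat \<Rightarrow> nat \<Rightarrow> nat \<Rightarrow> nat \<Rightarrow> real" and mu :: "nat \<Rightarrow> nat \<Rightarrow> nat \<Rightarrow> real"
  assumes p: "1 \<le> p" and posdef: "\<And>a. a \<in> {1, 2} \<Longrightarrow> pos_def p (Sig Lam a p)"
begin

abbreviation "Z \<equiv> \<lambda>(a, k, s). Y p a k s"

abbreviation "\<tau> i j \<equiv> mtrace p (mmult p (Sig Lam i p) (Sig Lam j p))"

lemma \<tau>_pos: "i \<in> {1, 2} \<Longrightarrow> j \<in> {1, 2} \<Longrightarrow> 0 < \<tau> i j"
  using mtrace_mmult_Sig_pos p posdef by blast

lemma cells_subset:
  assumes "fst ` S \<subseteq> {1, 2}"
  shows "cells p S \<subseteq> {(a, k, s). a \<in> {1, 2} \<and> s < p}"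
  using assms by (force simp: cells_def)

definition noise :: "nat \<times> nat \<Rightarrow> nat \<times> nat \<Rightarrow> 'a \<Rightarrow> nat \<Rightarrow> real" where
  "noise b b' \<omega> s = (\<Sum>u\<in>cells p {b, b'}. contrast Lam p b s u * Z u \<omega>)"

text \<open>The two differences involve disjoint observations, so their inner product is a decoupled
  bilinear form, and \<open>N\<close> is the trace of the product of the covariance matrices of the
  two differences.\<close>

lemma noise_inner_moments:
  assumes ne: "(i, k) \<noteq> (j, l)" "(i', k') \<noteq> (j', l')"
    and disj: "{(i, k), (j, l)} \<inter> {(i', k'), (j', l')} = {}"
    and s: "{i, j, i', j'} \<subseteq> {1, 2}"
  defines "q \<equiv> \<lambda>\<omega>. \<Sum>s<p. noise (i, k) (j, l) \<omega> s * noise (i', k') (j', l') \<omega> s"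
    and "N \<equiv> (\<Sum>s<p. \<Sum>t<p. (Sig Lam i p s t + Sig Lam j p s t) * (Sig Lam i' p s t + Sig Lam j' p s t))"
  shows "integrable M (\<lambda>\<omega>. q \<omega> ^ 4)"
    and "expectation (\<lambda>\<omega>. q \<omega> ^ 4) \<le> ((3 * \<gamma> + 4)\<^sup>2 * N)\<^sup>2"
    and "expectation (\<lambda>\<omega>. (q \<omega>)\<^sup>2) = N"
    and "expectation q = 0"
    and "factors_through Z (cells p {(i, k), (j, l), (i', k'), (j', l')}) q"
proof -
  have sub: "cells p {(i, k), (j, l)} \<subseteq> {(a, k, s). a \<in> {1, 2} \<and> s < p}"
    "cells p {(i', k'), (j', l')} \<subseteq> {(a, k, s). a \<in> {1, 2} \<and> s < p}"
    by (rule cells_subset; use s in simp)+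
  note m = inner_product_moments[OF finite_cells sub(1) finite_cells sub(2) cells_disjoint[OF disj],
      where S = "{..<p}" and A = "contrast Lam p (i, k)" and B = "contrast Lam p (i', k')",
      unfolded contrast_covariance[OF ne(1)] contrast_covariance[OF ne(2)]]
  show "integrable M (\<lambda>\<omega>. q \<omega> ^ 4)"
    and "expectation (\<lambda>\<omega>. q \<omega> ^ 4) \<le> ((3 * \<gamma> + 4)\<^sup>2 * N)\<^sup>2"
    and "expectation (\<lambda>\<omega>. (q \<omega>)\<^sup>2) = N"
    and "expectation q = 0"
    using m(1-4) by (simp_all add: q_def N_def noise_def)
  show "factors_through Z (cells p {(i, k), (j, l), (i', k'), (j', l')}) q"
  proof -
    have "{(i, k), (j, l), (i', k'), (j', l')} = {(i, k), (j, l)} \<union> {(i', k'), (j', l')}" by auto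
    then show ?thesis using m(5) by (simp add: cells_Un q_def noise_def del: Un_insert_left Un_insert_right)
  qed
qed

text \<open>A difference of two observations of sample \<open>i\<close> has covariance
  \<open>2 * \<Sigma>\<^sub>i\<close>, so the squared inner product has mean
  \<open>4 * \<tau> i j\<close>. Dividing by it gives mean 1; the same 4 stands in the denominators
  of \<open>Eone\<close> and \<open>Etwo\<close>.\<close>

definition trace_kernel :: "nat \<Rightarrow> nat \<Rightarrow> nat \<times> nat \<times> nat \<times> nat \<Rightarrow> 'a \<Rightarrow> real" where
  "trace_kernel i j = (\<lambda>(k, r, l, s) \<omega>.
     (vinner p (Dvec Lam mu Y p i k r \<omega>) (Dvec Lam mu Y p j l s \<omega>))\<^sup>2 / (4 * \<tau> i j))"

text \<open>The variance is at most the second moment, which is a fourth moment of \<open>q\<close>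
  divided by the square of \<open>E q\<^sup>2 = 4 * \<tau> i j\<close>. The fourth moment inequality
  makes \<open>\<tau>\<close> cancel and leaves \<open>((3 * \<gamma> + 4)\<^sup>2)\<^sup>2\<close>.
  For \<open>i = j\<close> the pairs of indices must be disjoint to keep the form decoupled.\<close>

lemma trace_kernel_moments:
  assumes ij: "i \<in> {1, 2}" "j \<in> {1, 2}"
    and J: "J = (k, r, l, s)" "k \<noteq> r" "l \<noteq> s" "i = j \<Longrightarrow> {k, r} \<inter> {l, s} = {}"
  shows "factors_through Z (cells p (observations i j J)) (trace_kernel i j J)"
    and "cells p (observations i j J) \<subseteq> {(a, k, s). a \<in> {1, 2} \<and> s < p}"
    and "integrable M (\<lambda>\<omega>. (trace_kernel i j J \<omega>)\<^sup>2)"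
    and "expectation (trace_kernel i j J) = 1"
    and "expectation (\<lambda>\<omega>. (trace_kernel i j J \<omega> - 1)\<^sup>2) \<le> (3 * \<gamma> + 4) ^ 4"
proof -
  define q where "q \<omega> = (\<Sum>t<p. noise (i, k) (i, r) \<omega> t * noise (j, l) (j, s) \<omega> t)" for \<omega>
  have \<tau>: "0 < \<tau> i j" using \<tau>_pos ij by blast
  have ne: "(i, k) \<noteq> (i, r)" "(j, l) \<noteq> (j, s)" "{(i, k), (i, r)} \<inter> {(j, l), (j, s)} = {}"
    "{i, i, j, j} \<subseteq> {1, 2}"
    using J ij by auto
  have h: "trace_kernel i j J = (\<lambda>\<omega>. (q \<omega>)\<^sup>2 / (4 * \<tau> i j))"
    unfolding J(1) trace_kernel_def prod.case q_def vinner_def Dvec_def noise_def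
      obs_diff_eq[OF ne(1)] obs_diff_eq[OF ne(2)] by simp
  have N: "(\<Sum>s<p. \<Sum>t<p. (Sig Lam i p s t + Sig Lam i p s t) * (Sig Lam j p s t + Sig Lam j p s t)) = 4 * \<tau> i j"
    unfolding mtrace_mmult_Sig by (simp add: sum_distrib_left)
  note m = noise_inner_moments[OF ne, folded q_def, unfolded N]
  show sub: "cells p (observations i j J) \<subseteq> {(a, k, s). a \<in> {1, 2} \<and> s < p}"
    using ij by (intro cells_subset) (auto simp: observations_def J(1))
  have fq: "factors_through Z (cells p (observations i j J)) q"
    using m(5) by (simp add: observations_def J(1))
  have "factors_through Z (cells p (observations i j J)) (\<lambda>\<omega>. (q \<omega>)\<^sup>2 * (1 / (4 * \<tau> i j)))"
    by (intro factors_through_mult factors_through_power fq factors_through_const)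
  then show "factors_through Z (cells p (observations i j J)) (trace_kernel i j J)"
    by (simp add: h)
  have h2: "(\<lambda>\<omega>. (trace_kernel i j J \<omega>)\<^sup>2) = (\<lambda>\<omega>. q \<omega> ^ 4 / (4 * \<tau> i j)\<^sup>2)"
    by (simp add: h power_divide flip: power_mult)
  show int2: "integrable M (\<lambda>\<omega>. (trace_kernel i j J \<omega>)\<^sup>2)"
    unfolding h2 using m(1) by simp
  show mean1: "expectation (trace_kernel i j J) = 1"
    using m(3) \<tau> by (simp add: h)
  have rv: "random_variable borel (trace_kernel i j J)"
    unfolding h using random_variable_factors_through[OF fq sub] by measurable
  have int: "integrable M (trace_kernel i j J)"
    using square_integrable_imp_integrable[OF rv int2] .
  have "expectation (\<lambda>\<omega>. (trace_kernel i j J \<omega> - 1)\<^sup>2)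
      = expectation (\<lambda>\<omega>. (trace_kernel i j J \<omega>)\<^sup>2) - 1"
    unfolding power2_diff using int int2 mean1 by (simp add: prob_space)
  also have "\<dots> \<le> expectation (\<lambda>\<omega>. q \<omega> ^ 4) / (4 * \<tau> i j)\<^sup>2"
    unfolding h2 by simp
  also have "\<dots> \<le> ((3 * \<gamma> + 4)\<^sup>2 * (4 * \<tau> i j))\<^sup>2 / (4 * \<tau> i j)\<^sup>2"
    using m(2) by (intro divide_right_mono) auto
  also have "\<dots> = (3 * \<gamma> + 4) ^ 4"
    using \<tau> by (simp add: power_mult_distrib flip: power_mult)
  finally show "expectation (\<lambda>\<omega>. (trace_kernel i j J \<omega> - 1)\<^sup>2) \<le> (3 * \<gamma> + 4) ^ 4" .
qed

lemma trace_kernel_distinct_quads: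
  assumes "i \<in> {1, 2}" "J \<in> distinct_quads n"
  shows "factors_through Z (cells p (observations i i J)) (trace_kernel i i J)"
    and "cells p (observations i i J) \<subseteq> {(a, k, s). a \<in> {1, 2} \<and> s < p}"
    and "integrable M (\<lambda>\<omega>. (trace_kernel i i J \<omega>)\<^sup>2)"
    and "expectation (trace_kernel i i J) = 1"
    and "expectation (\<lambda>\<omega>. (trace_kernel i i J \<omega> - 1)\<^sup>2) \<le> (3 * \<gamma> + 4) ^ 4"
proof -
  obtain k r l s where J: "J = (k, r, l, s)" by (metis prod.exhaust)
  have "k \<noteq> r" "l \<noteq> s" "{k, r} \<inter> {l, s} = {}" using assms(2) by (auto simp: J quads_def)
  note m = trace_kernel_moments[OF assms(1,1) J this]
  show "factors_through Z (cells p (observations i i J)) (trace_kernel i i J)"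
    "cells p (observations i i J) \<subseteq> {(a, k, s). a \<in> {1, 2} \<and> s < p}"
    "integrable M (\<lambda>\<omega>. (trace_kernel i i J \<omega>)\<^sup>2)"
    "expectation (trace_kernel i i J) = 1"
    "expectation (\<lambda>\<omega>. (trace_kernel i i J \<omega> - 1)\<^sup>2) \<le> (3 * \<gamma> + 4) ^ 4"
    by (fact m)+
qed

lemma trace_kernel_paired_quads:
  assumes "i \<in> {1, 2}" "j \<in> {1, 2}" "i \<noteq> j" "J \<in> paired_quads n m"
  shows "factors_through Z (cells p (observations i j J)) (trace_kernel i j J)"
    and "cells p (observations i j J) \<subseteq> {(a, k, s). a \<in> {1, 2} \<and> s < p}"
    and "integrable M (\<lambda>\<omega>. (trace_kernel i j J \<omega>)\<^sup>2)"
    and "expectation (trace_kernel i j J) = 1"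
    and "expectation (\<lambda>\<omega>. (trace_kernel i j J \<omega> - 1)\<^sup>2) \<le> (3 * \<gamma> + 4) ^ 4"
proof -
  obtain k r l s where J: "J = (k, r, l, s)" by (metis prod.exhaust)
  have "k \<noteq> r" "l \<noteq> s" using assms(4) by (auto simp: J quads_def)
  note m = trace_kernel_moments[OF assms(1,2) J this]
  show "factors_through Z (cells p (observations i j J)) (trace_kernel i j J)"
    "cells p (observations i j J) \<subseteq> {(a, k, s). a \<in> {1, 2} \<and> s < p}"
    "integrable M (\<lambda>\<omega>. (trace_kernel i j J \<omega>)\<^sup>2)"
    "expectation (trace_kernel i j J) = 1"
    "expectation (\<lambda>\<omega>. (trace_kernel i j J \<omega> - 1)\<^sup>2) \<le> (3 * \<gamma> + 4) ^ 4"
    by (rule m; use assms(3) in simp)+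
qed

lemma Eone_eq_average:
  assumes i: "i \<in> {1, 2}" and n: "4 \<le> n"
  shows "Eone Lam mu Y p i n = (\<lambda>\<omega>. \<tau> i i / (real p)\<^sup>2 *
    ((\<Sum>J\<in>distinct_quads n. trace_kernel i i J \<omega>) / real (card (distinct_quads n))))"
proof
  fix \<omega>
  have \<tau>: "\<tau> i i \<noteq> 0" using \<tau>_pos[OF i i] by simp
  have "(\<Sum>J\<in>distinct_quads n. trace_kernel i i J \<omega>)
      = (\<Sum>(k, r, l, s)\<in>distinct_quads n.
          (vinner p (Dvec Lam mu Y p i k r \<omega>) (Dvec Lam mu Y p i l s \<omega>))\<^sup>2) / (4 * \<tau> i i)"
    by (simp add: trace_kernel_def case_prod_unfold sum_divide_distrib del: distinct.simps)
  then show "Eone Lam mu Y p i n \<omega> = \<tau> i i / (real p)\<^sup>2 *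
      ((\<Sum>J\<in>distinct_quads n. trace_kernel i i J \<omega>) / real (card (distinct_quads n)))"
    unfolding Eone_def sum_quads card_distinct_quads[OF n] using \<tau> by simp
qed

lemma Etwo_eq_average:
  assumes ij: "i \<in> {1, 2}" "j \<in> {1, 2}" and nm: "4 \<le> n" "4 \<le> m"
  shows "Etwo Lam mu Y p i j n m = (\<lambda>\<omega>. \<tau> i j / (real p)\<^sup>2 *
    ((\<Sum>J\<in>paired_quads n m. trace_kernel i j J \<omega>) / real (card (paired_quads n m))))"
proof
  fix \<omega>
  have \<tau>: "\<tau> i j \<noteq> 0" using \<tau>_pos[OF ij] by simp
  have "(\<Sum>J\<in>paired_quads n m. trace_kernel i j J \<omega>)
      = (\<Sum>(k, r, l, s)\<in>paired_quads n m.
          (vinner p (Dvec Lam mu Y p i k r \<omega>) (Dvec Lam mu Y p j l s \<omega>))\<^sup>2) / (4 * \<tau> i j)"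
    by (simp add: trace_kernel_def case_prod_unfold sum_divide_distrib)
  then show "Etwo Lam mu Y p i j n m \<omega> = \<tau> i j / (real p)\<^sup>2 *
      ((\<Sum>J\<in>paired_quads n m. trace_kernel i j J \<omega>) / real (card (paired_quads n m)))"
    unfolding Etwo_def sum_quads card_paired_quads[OF nm] using \<tau> by simp
qed

end

section \<open>Variances, and pairs of kernels with common variables\<close>

lemma var_eq_covariance: "var M f = covariance M f f"
  by (simp add: var_def covariance_def power2_eq_square)

lemma var_divide: "var M (\<lambda>\<omega>. f \<omega> / c) = var M f / c\<^sup>2"
  by (simp add: var_def power_divide flip: diff_divide_distrib)

text \<open>Cells can meet only when the underlying observations do, so counts of quadruples carry
  over to index sets of variables.\<close>

lemma cells_meeting_pairs_le:
  assumes "finite A" "finite B"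
    and "real (card {(J, J') \<in> A \<times> B. S J \<inter> T J' \<noteq> {}}) \<le> b"
  shows "real (card {(J, J') \<in> A \<times> B. cells p (S J) \<inter> cells p (T J') \<noteq> {}}) \<le> b"
proof -
  have "finite {(J, J') \<in> A \<times> B. S J \<inter> T J' \<noteq> {}}"
    by (rule finite_subset[of _ "A \<times> B"]) (use assms(1,2) in auto)
  then have "card {(J, J') \<in> A \<times> B. cells p (S J) \<inter> cells p (T J') \<noteq> {}}
      \<le> card {(J, J') \<in> A \<times> B. S J \<inter> T J' \<noteq> {}}"
    by (rule card_mono) (auto simp: cells_def)
  then show ?thesis using assms(3) by linarith
qed

lemma finite_observations: "finite (observations i j J)"
  by (cases J) (simp add: observations_def)

text \<open>\<open>172 = 4 * 43\<close>: at most four observations per quadruple, each contained in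
  at most a fraction \<open>43 / n\<close> of the quadruples.\<close>

lemma distinct_quads_meeting_le:
  assumes n: "4 \<le> n"
  shows "real (card {(J, J') \<in> distinct_quads n \<times> distinct_quads n.
      cells p (observations i i J) \<inter> cells p (observations i i J') \<noteq> {}})
    \<le> 172 / real n * (real (card (distinct_quads n)) * real (card (distinct_quads n)))"
proof -
  have "real (card {(J, J') \<in> distinct_quads n \<times> distinct_quads n.
      observations i i J \<inter> observations i i J' \<noteq> {}})
    \<le> real 4 * (43 / real n) * (real (card (distinct_quads n)) * real (card (distinct_quads n)))"
    by (rule card_meeting_pairs_le)
      (use card_observations_le finite_observations card_distinct_quads_containing_le[OF n] in
        \<open>auto simp del: distinct.simps\<close>)
  from cells_meeting_pairs_le[OF _ _ this] show ?thesis by simp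
qed

text \<open>A common observation may come from either sample, at the price of a fraction
  \<open>43 / n\<close> or \<open>43 / m\<close>; the sum covers both cases.\<close>

lemma paired_quads_meeting_le:
  assumes nm: "4 \<le> n" "4 \<le> m" and ij: "i \<noteq> j"
  shows "real (card {(J, J') \<in> paired_quads n m \<times> paired_quads n m.
      cells p (observations i j J) \<inter> cells p (observations i j J') \<noteq> {}})
    \<le> 172 * (1 / real n + 1 / real m) * (real (card (paired_quads n m)) * real (card (paired_quads n m)))"
proof -
  have le: "real (card {J' \<in> paired_quads n m. x \<in> observations i j J'})
      \<le> 43 * (1 / real n + 1 / real m) * real (card (paired_quads n m))"
    if x: "x \<in> observations i j J" for x J
  proof -
    obtain y where "x = (i, y) \<or> x = (j, y)" using x by (auto simp: observations_def split: prod.splits)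
    then have "real (card {J' \<in> paired_quads n m. x \<in> observations i j J'})
        \<le> 43 / real n * real (card (paired_quads n m)) \<or>
      real (card {J' \<in> paired_quads n m. x \<in> observations i j J'})
        \<le> 43 / real m * real (card (paired_quads n m))"
      by (rule disj_forward) (simp_all only: card_paired_quads_containing_le[OF nm ij])
    moreover have "0 \<le> 43 / real n * real (card (paired_quads n m))"
      "0 \<le> 43 / real m * real (card (paired_quads n m))" by simp_all
    moreover have "43 * (1 / real n + 1 / real m) * real (card (paired_quads n m))
        = 43 / real n * real (card (paired_quads n m)) + 43 / real m * real (card (paired_quads n m))"
      by (simp add: algebra_simps)
    ultimately show ?thesis by linarith
  qed
  have "real (card {(J, J') \<in> paired_quads n m \<times> paired_quads n m.
      observations i j J \<inter> observations i j J' \<noteq> {}})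
    \<le> real 4 * (43 * (1 / real n + 1 / real m)) * (real (card (paired_quads n m)) * real (card (paired_quads n m)))"
    by (rule card_meeting_pairs_le) (use card_observations_le finite_observations le in auto)
  from cells_meeting_pairs_le[OF _ _ this] show ?thesis by (simp add: mult.assoc)
qed

text \<open>A quadruple within sample \<open>i\<close> can share only observations of sample
  \<open>i\<close>, so \<open>m\<close> does not enter. This is why the covariance is governed by
  \<open>1 / n\<close> alone.\<close>

lemma distinct_paired_quads_meeting_le:
  assumes nm: "4 \<le> n" "4 \<le> m" and ij: "i \<noteq> j"
  shows "real (card {(J, J') \<in> distinct_quads n \<times> paired_quads n m.
      cells p (observations i i J) \<inter> cells p (observations i j J') \<noteq> {}})
    \<le> 172 / real n * (real (card (distinct_quads n)) * real (card (paired_quads n m)))"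
proof -
  have le: "real (card {J' \<in> paired_quads n m. x \<in> observations i j J'})
      \<le> 43 / real n * real (card (paired_quads n m))"
    if x: "x \<in> observations i i J" for x J
  proof -
    obtain y where "x = (i, y)" using x by (auto simp: observations_def split: prod.splits)
    then show ?thesis using card_paired_quads_containing_le(1)[OF nm ij, of y] by simp
  qed
  have "real (card {(J, J') \<in> distinct_quads n \<times> paired_quads n m.
      observations i i J \<inter> observations i j J' \<noteq> {}})
    \<le> real 4 * (43 / real n) * (real (card (distinct_quads n)) * real (card (paired_quads n m)))"
    by (rule card_meeting_pairs_le)
      (use card_observations_le finite_observations le in \<open>auto simp del: distinct.simps\<close>)
  from cells_meeting_pairs_le[OF _ _ this] show ?thesis by simp
qed

section \<open>The kernel of the squared mean distance\<close>

context two_sample_model begin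

text \<open>Unlike in \<open>trace_kernel\<close>, the differences are taken across the samples,
  \<open>k\<close> with \<open>l\<close> and \<open>r\<close> with \<open>s\<close>: each then has
  mean \<open>mu 1 p - mu 2 p\<close>, and the two are independent when \<open>k \<noteq> r\<close>
  and \<open>l \<noteq> s\<close>.\<close>

definition mean_kernel :: "nat \<times> nat \<times> nat \<times> nat \<Rightarrow> 'a \<Rightarrow> real" where
  "mean_kernel = (\<lambda>(k, r, l, s) \<omega>.
     vinner p (\<lambda>t. obs Lam mu Y p 1 k \<omega> t - obs Lam mu Y p 2 l \<omega> t)
       (\<lambda>t. obs Lam mu Y p 1 r \<omega> t - obs Lam mu Y p 2 s \<omega> t) / real p)"

lemma E0_eq_average:
  assumes nm: "4 \<le> n" "4 \<le> m"
  shows "E0 Lam mu Y p n m = (\<lambda>\<omega>. (\<Sum>J\<in>paired_quads n m. mean_kernel J \<omega>) / real (card (paired_quads n m)))"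
proof
  fix \<omega>
  define G where "G = (\<lambda>k r. vinner p (obs Lam mu Y p 1 k \<omega>) (obs Lam mu Y p 1 r \<omega>))"
  define H where "H = (\<lambda>k l. vinner p (obs Lam mu Y p 1 k \<omega>) (obs Lam mu Y p 2 l \<omega>))"
  define K where "K = (\<lambda>l s. vinner p (obs Lam mu Y p 2 l \<omega>) (obs Lam mu Y p 2 s \<omega>))"
  define g h f where "g = (\<Sum>k<n. \<Sum>r<n. if k \<noteq> r then G k r else 0)"
    "h = (\<Sum>k<n. \<Sum>l<m. H k l)" "f = (\<Sum>l<m. \<Sum>s<m. if l \<noteq> s then K l s else 0)"
  have kernel: "mean_kernel (k, r, l, s) \<omega> = (G k r - H k s - H r l + K l s) / real p" for k r l s
    by (simp add: mean_kernel_def G_def H_def K_def vinner_def algebra_simps sum.distrib sum_subtractf)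
  have "(\<Sum>J\<in>paired_quads n m. mean_kernel J \<omega>)
      = (\<Sum>(k, r, l, s)\<in>paired_quads n m. G k r - H k s - H r l + K l s) / real p"
    unfolding sum_divide_distrib by (intro sum.cong refl) (auto simp: kernel)
  also have "\<dots> = (real m * (real m - 1) * g + real n * (real n - 1) * f
      - 2 * ((real n - 1) * (real m - 1) * h)) / real p"
    unfolding sum_paired_quads_differences[OF nm] g_h_f_def ..
  finally have "(\<Sum>J\<in>paired_quads n m. mean_kernel J \<omega>) / real (card (paired_quads n m))
    = (real m * (real m - 1) * g + real n * (real n - 1) * f
      - 2 * ((real n - 1) * (real m - 1) * h)) / real p / (real n * real m * (real n - 1) * (real m - 1))"
    unfolding card_paired_quads[OF nm] by simp
  also have "\<dots> = g / (real p * real n * (real n - 1)) + f / (real p * real m * (real m - 1))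
      - 2 * (h / (real p * real n * real m))"
  proof -
    \<comment> \<open>For arbitrary nonzero reals the identity is purely one of fractions:
      \<open>n\<close> and \<open>n - 1\<close> are treated as unrelated.\<close>
    have "P \<noteq> 0 \<Longrightarrow> N \<noteq> 0 \<Longrightarrow> N' \<noteq> 0 \<Longrightarrow> L \<noteq> 0 \<Longrightarrow> L' \<noteq> 0 \<Longrightarrow>
      (L * L' * g + N * N' * f - 2 * (N' * L' * h)) / P / (N * L * N' * L')
        = g / (P * N * N') + f / (P * L * L') - 2 * (h / (P * N * L))" for P N N' L L' :: real
      by (simp add: field_simps)
    from this[of "real p" "real n" "real n - 1" "real m" "real m - 1"]
    show ?thesis using nm p by simp
  qed
  also have "\<dots> = E0 Lam mu Y p n m \<omega>"
    unfolding E0_def U_one_def U_two_def g_h_f_def G_def H_def K_def ..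
  finally show "E0 Lam mu Y p n m \<omega> = (\<Sum>J\<in>paired_quads n m. mean_kernel J \<omega>) / real (card (paired_quads n m))"
    by simp
qed

abbreviation "gap s \<equiv> mu 1 p s - mu 2 p s"

abbreviation "pooled s t \<equiv> Sig Lam 1 p s t + Sig Lam 2 p s t"

text \<open>In matrix terms \<open>3 * (2 * \<delta>'(\<Sigma>\<^sub>1 + \<Sigma>\<^sub>2)\<delta> +
  tr ((\<Sigma>\<^sub>1 + \<Sigma>\<^sub>2)\<^sup>2)) / p\<^sup>2\<close>: the variances of two
  linear terms and one bilinear term, with the factor 3 from squaring a sum of three.\<close>

definition mean_kernel_bound :: real where
  "mean_kernel_bound = 3 * (2 * (\<Sum>s<p. \<Sum>t<p. gap s * gap t * pooled s t)
     + (\<Sum>s<p. \<Sum>t<p. (pooled s t)\<^sup>2)) / (real p)\<^sup>2"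

lemma shift_noise_moments:
  defines "f \<equiv> \<lambda>k l \<omega>. \<Sum>s<p. gap s * noise (1, k) (2, l) \<omega> s"
  shows "integrable M (f k l)"
    and "integrable M (\<lambda>\<omega>. (f k l \<omega>)\<^sup>2)"
    and "expectation (\<lambda>\<omega>. (f k l \<omega>)\<^sup>2) = (\<Sum>s<p. \<Sum>t<p. gap s * gap t * pooled s t)"
    and "expectation (f k l) = 0"
    and "factors_through Z (cells p {(1, k), (2, l)}) (f k l)"
proof -
  let ?R = "cells p {(1, k), (2, l)}"
  let ?c = "\<lambda>u. \<Sum>s<p. gap s * contrast Lam p (1, k) s u"
  have ne: "(1::nat, k) \<noteq> (2, l)" by simp
  have sub: "?R \<subseteq> {(a, k, s). a \<in> {1, 2} \<and> s < p}" by (rule cells_subset) simp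
  have fin: "finite ?R" by (simp add: finite_cells)
  have f: "f k l \<omega> = (\<Sum>u\<in>?R. ?c u * Z u \<omega>)" for \<omega>
    unfolding f_def noise_def sum_distrib_left sum_distrib_right
    by (subst sum.swap) (simp add: mult.assoc)
  note m = linear_form_moments[OF fin sub, where c = ?c, folded f]
  show "factors_through Z ?R (f k l)" "expectation (f k l) = 0" using m(4,5) by simp_all
  have rv: "random_variable borel (f k l)"
    using random_variable_factors_through[OF m(5) sub] .
  show "integrable M (f k l)" "integrable M (\<lambda>\<omega>. (f k l \<omega>)\<^sup>2)"
    using integrable_power_le_4[OF rv m(1), of 1] integrable_power_le_4[OF rv m(1), of 2] by simp_all
  \<comment> \<open>A dummy sum over one point brings the expression into the shape of
    \<open>sum_square_coefficients_eq\<close>, with \<open>gap\<close> as the single column of the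
    first matrix.\<close>
  have "(\<Sum>v\<in>?R. (?c v)\<^sup>2) = (\<Sum>u\<in>{()}. \<Sum>v\<in>?R. (?c v)\<^sup>2)" by simp
  also have "\<dots> = (\<Sum>s<p. \<Sum>t<p. gap s * gap t * pooled s t)"
    unfolding sum_square_coefficients_eq contrast_covariance[OF ne] by simp
  finally show "expectation (\<lambda>\<omega>. (f k l \<omega>)\<^sup>2) = (\<Sum>s<p. \<Sum>t<p. gap s * gap t * pooled s t)"
    using m(3) by simp
qed

text \<open>The product of two shifted noises expands into the constant
  \<open>\<delta>'\<delta>\<close>, two linear forms \<open>\<alpha>\<close>, \<open>\<beta>\<close>
  and a decoupled bilinear form \<open>q\<close>, all three centred. Bounding the square of their
  sum by three times the sum of squares avoids their cross moments.\<close>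

lemma mean_kernel_moments:
  assumes "J \<in> paired_quads n m"
  shows "factors_through Z (cells p (observations 1 2 J)) (mean_kernel J)"
    and "cells p (observations 1 2 J) \<subseteq> {(a, k, s). a \<in> {1, 2} \<and> s < p}"
    and "integrable M (\<lambda>\<omega>. (mean_kernel J \<omega>)\<^sup>2)"
    and "expectation (mean_kernel J) = mudist mu p"
    and "expectation (\<lambda>\<omega>. (mean_kernel J \<omega> - mudist mu p)\<^sup>2) \<le> mean_kernel_bound"
proof -
  obtain k r l s where J: "J = (k, r, l, s)" by (metis prod.exhaust)
  have ne: "(1::nat, k) \<noteq> (2, l)" "(1::nat, r) \<noteq> (2, s)" "{(1::nat, k), (2, l)} \<inter> {(1, r), (2, s)} = {}"
    "{1, 2, 1, 2} \<subseteq> {1, 2::nat}"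
    using assms by (auto simp: J quads_def)
  define \<alpha> where "\<alpha> \<omega> = (\<Sum>t<p. gap t * noise (1, k) (2, l) \<omega> t)" for \<omega>
  define \<beta> where "\<beta> \<omega> = (\<Sum>t<p. gap t * noise (1, r) (2, s) \<omega> t)" for \<omega>
  define q where "q \<omega> = (\<Sum>t<p. noise (1, k) (2, l) \<omega> t * noise (1, r) (2, s) \<omega> t)" for \<omega>
  note a = shift_noise_moments[of k l, folded \<alpha>_def]
  note b = shift_noise_moments[of r s, folded \<beta>_def]
  note c = noise_inner_moments[OF ne, folded q_def]
  let ?K = "cells p (observations 1 2 J)"
  show sub: "?K \<subseteq> {(a, k, s). a \<in> {1, 2} \<and> s < p}"
    by (intro cells_subset) (auto simp: observations_def J(1))
  have fac: "factors_through Z ?K \<alpha>" "factors_through Z ?K \<beta>" "factors_through Z ?K q"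
    by (rule factors_through_mono[OF a(5)] factors_through_mono[OF b(5)] factors_through_mono[OF c(5)];
        force simp: cells_def observations_def J)+
  have rvq: "random_variable borel q" using random_variable_factors_through[OF fac(3) sub] .
  have q: "integrable M q" "integrable M (\<lambda>\<omega>. (q \<omega>)\<^sup>2)"
    using integrable_power_le_4[OF rvq c(1), of 1] integrable_power_le_4[OF rvq c(1), of 2] by simp_all
  have h: "mean_kernel J = (\<lambda>\<omega>. mudist mu p + (\<alpha> \<omega> + \<beta> \<omega> + q \<omega>) * (1 / real p))"
  proof
    fix \<omega>
    have "mean_kernel J \<omega> = (\<Sum>t<p. (gap t + noise (1, k) (2, l) \<omega> t) * (gap t + noise (1, r) (2, s) \<omega> t)) / real p"
      unfolding J mean_kernel_def prod.case vinner_def noise_def obs_diff_eq[OF ne(1)] obs_diff_eq[OF ne(2)] by simp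
    also have "(\<Sum>t<p. (gap t + noise (1, k) (2, l) \<omega> t) * (gap t + noise (1, r) (2, s) \<omega> t))
        = (\<Sum>t<p. gap t * gap t) + (\<alpha> \<omega> + \<beta> \<omega> + q \<omega>)"
      unfolding \<alpha>_def \<beta>_def q_def sum.distrib[symmetric]
      by (intro sum.cong refl) (simp only: distrib_left distrib_right mult_ac add_ac)
    finally show "mean_kernel J \<omega> = mudist mu p + (\<alpha> \<omega> + \<beta> \<omega> + q \<omega>) * (1 / real p)"
      by (simp add: mudist_def vinner_def add_divide_distrib)
  qed
  show fh: "factors_through Z ?K (mean_kernel J)"
    unfolding h by (intro factors_through_intros fac)
  show "expectation (mean_kernel J) = mudist mu p"
    unfolding h using a(1,4) b(1,4) q(1) c(4) by (simp add: prob_space)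
  have sq: "(\<lambda>\<omega>. (mean_kernel J \<omega> - mudist mu p)\<^sup>2) = (\<lambda>\<omega>. (\<alpha> \<omega> + \<beta> \<omega> + q \<omega>)\<^sup>2 / (real p)\<^sup>2)"
    by (simp add: h power_divide)
  have le: "(\<alpha> \<omega> + \<beta> \<omega> + q \<omega>)\<^sup>2 \<le> 3 * ((\<alpha> \<omega>)\<^sup>2 + (\<beta> \<omega>)\<^sup>2 + (q \<omega>)\<^sup>2)" for \<omega>
  proof -
    have "0 \<le> (\<alpha> \<omega> - \<beta> \<omega>)\<^sup>2 + (\<alpha> \<omega> - q \<omega>)\<^sup>2 + (\<beta> \<omega> - q \<omega>)\<^sup>2" by simp
    then show ?thesis by (simp add: power2_eq_square algebra_simps)
  qed
  have bound_int: "integrable M (\<lambda>\<omega>. 3 * ((\<alpha> \<omega>)\<^sup>2 + (\<beta> \<omega>)\<^sup>2 + (q \<omega>)\<^sup>2))"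
    using a(2) b(2) q(2) by simp
  have rv: "random_variable borel \<alpha>" "random_variable borel \<beta>"
    using random_variable_factors_through[OF fac(1) sub] random_variable_factors_through[OF fac(2) sub] by auto
  have sq_int: "integrable M (\<lambda>\<omega>. (\<alpha> \<omega> + \<beta> \<omega> + q \<omega>)\<^sup>2)"
  proof (rule Bochner_Integration.integrable_bound[OF bound_int])
    show "(\<lambda>\<omega>. (\<alpha> \<omega> + \<beta> \<omega> + q \<omega>)\<^sup>2) \<in> borel_measurable M" using rv rvq by measurable
    show "AE \<omega> in M. norm ((\<alpha> \<omega> + \<beta> \<omega> + q \<omega>)\<^sup>2) \<le> norm (3 * ((\<alpha> \<omega>)\<^sup>2 + (\<beta> \<omega>)\<^sup>2 + (q \<omega>)\<^sup>2))"
      using le by (auto intro: order_trans)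
  qed
  have "integrable M (\<lambda>\<omega>. (mudist mu p)\<^sup>2 + ((\<alpha> \<omega> + \<beta> \<omega> + q \<omega>) * (2 * mudist mu p / real p)
      + (\<alpha> \<omega> + \<beta> \<omega> + q \<omega>)\<^sup>2 * (1 / (real p)\<^sup>2)))"
    using sq_int a(1) b(1) q(1) by (intro Bochner_Integration.integrable_add integrable_mult_left) auto
  also have "(\<lambda>\<omega>. (mudist mu p)\<^sup>2 + ((\<alpha> \<omega> + \<beta> \<omega> + q \<omega>) * (2 * mudist mu p / real p)
      + (\<alpha> \<omega> + \<beta> \<omega> + q \<omega>)\<^sup>2 * (1 / (real p)\<^sup>2))) = (\<lambda>\<omega>. (mean_kernel J \<omega>)\<^sup>2)"
    by (rule ext) (simp add: h power2_sum power_divide)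
  finally show "integrable M (\<lambda>\<omega>. (mean_kernel J \<omega>)\<^sup>2)" .
  have "expectation (\<lambda>\<omega>. (\<alpha> \<omega> + \<beta> \<omega> + q \<omega>)\<^sup>2) \<le> expectation (\<lambda>\<omega>. 3 * ((\<alpha> \<omega>)\<^sup>2 + (\<beta> \<omega>)\<^sup>2 + (q \<omega>)\<^sup>2))"
    by (rule integral_mono[OF sq_int bound_int le])
  also have "\<dots> = 3 * (2 * (\<Sum>s<p. \<Sum>t<p. gap s * gap t * pooled s t) + (\<Sum>s<p. \<Sum>t<p. (pooled s t)\<^sup>2))"
    using a(2,3) b(2,3) q(2) c(3) by (simp add: power2_eq_square)
  finally show "expectation (\<lambda>\<omega>. (mean_kernel J \<omega> - mudist mu p)\<^sup>2) \<le> mean_kernel_bound"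
    unfolding sq mean_kernel_bound_def by (simp add: divide_right_mono)
qed

end

section \<open>Bounds uniform in the dimension\<close>

text \<open>\<open>O(1)\<close> controls large \<open>p\<close> only; the finitely many smaller
  dimensions are covered by adding all their absolute values to the constant.\<close>

lemma bigo_one_imp_bounded:
  fixes f :: "nat \<Rightarrow> real"
  assumes "f \<in> O(\<lambda>_. 1)"
  shows "\<exists>K. \<forall>p. \<bar>f p\<bar> \<le> K"
proof -
  obtain c where "eventually (\<lambda>p. norm (f p) \<le> c * norm (1::real)) at_top"
    using landau_o.bigE[OF assms] by blast
  then obtain N where N: "\<And>p. N \<le> p \<Longrightarrow> \<bar>f p\<bar> \<le> c"
    by (auto simp: eventually_at_top_linorder)
  have "\<bar>f p\<bar> \<le> \<bar>c\<bar> + (\<Sum>q<N. \<bar>f q\<bar>)" for p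
  proof (cases "p < N")
    case True
    then have "\<bar>f p\<bar> \<le> (\<Sum>q<N. \<bar>f q\<bar>)" by (intro member_le_sum) auto
    then show ?thesis by linarith
  next
    case False
    then have "\<bar>f p\<bar> \<le> c" using N by simp
    moreover have "0 \<le> (\<Sum>q<N. \<bar>f q\<bar>)" by (rule sum_nonneg) simp
    ultimately show ?thesis by linarith
  qed
  then show ?thesis by blast
qed

lemma finite_family_bigo_one_imp_bounded:
  fixes f :: "'x \<Rightarrow> nat \<Rightarrow> real"
  assumes "finite S" "\<And>x. x \<in> S \<Longrightarrow> f x \<in> O(\<lambda>_. 1)"
  shows "\<exists>K. \<forall>x\<in>S. \<forall>p. \<bar>f x p\<bar> \<le> K"
  using assms
proof (induction S rule: finite_induct)
  case empty
  then show ?case by simp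
next
  case (insert x S)
  then obtain K where K: "\<forall>y\<in>S. \<forall>p. \<bar>f y p\<bar> \<le> K" by auto
  obtain K' where K': "\<forall>p. \<bar>f x p\<bar> \<le> K'" using bigo_one_imp_bounded insert.prems by blast
  have "\<forall>y\<in>insert x S. \<forall>p. \<bar>f y p\<bar> \<le> max K K'"
    using K K' by (auto simp: le_max_iff_disj)
  then show ?case by blast
qed

text \<open>Chebyshev's inequality with a variance bound that tends to zero. The hypotheses are
  asked for only eventually, because growing sample sizes reach 4 only from some index on.\<close>

lemma (in prob_space) deviation_tendsto_zero:
  fixes f :: "nat \<Rightarrow> 'a \<Rightarrow> real"
  assumes f: "eventually (\<lambda>m. random_variable borel (f m) \<and> integrable M (\<lambda>\<omega>. (f m \<omega>)\<^sup>2)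
      \<and> expectation (f m) = c \<and> var M (f m) \<le> b m) sequentially"
    and b: "b \<longlonglongrightarrow> 0" and e: "0 < e"
  shows "(\<lambda>m. measure M {\<omega> \<in> space M. \<bar>f m \<omega> - c\<bar> > e}) \<longlonglongrightarrow> 0"
proof (rule tendsto_sandwich[OF _ _ tendsto_const])
  show "\<forall>\<^sub>F m in sequentially. 0 \<le> measure M {\<omega> \<in> space M. \<bar>f m \<omega> - c\<bar> > e}" by simp
  show "(\<lambda>m. b m / e\<^sup>2) \<longlonglongrightarrow> 0" using tendsto_divide[OF b tendsto_const, of "e\<^sup>2"] e by simp
  show "\<forall>\<^sub>F m in sequentially. measure M {\<omega> \<in> space M. \<bar>f m \<omega> - c\<bar> > e} \<le> b m / e\<^sup>2"
    using f
  proof eventually_elim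
    case (elim m)
    then have [measurable]: "random_variable borel (f m)" by blast
    have "measure M {\<omega> \<in> space M. \<bar>f m \<omega> - c\<bar> > e} \<le> measure M {\<omega> \<in> space M. \<bar>f m \<omega> - c\<bar> \<ge> e}"
      by (intro finite_measure_mono) auto
    also have "\<dots> \<le> var M (f m) / e\<^sup>2"
      using Chebyshev_inequality[of "f m" e] elim e by (simp add: var_def)
    also have "\<dots> \<le> b m / e\<^sup>2" using elim by (intro divide_right_mono) auto
    finally show ?case .
  qed
qed

section \<open>Bounds for the estimators and their ratios\<close>

context two_sample_model begin

text \<open>Expanding \<delta> and the pooled covariance gives eight forms, each at most
  \<open>K * p\<close>; with the factor \<open>3 * 2\<close> this is \<open>48 * K * p\<close>. The
  Frobenius term is at most the squared trace, hence at most \<open>(2 * K * p)\<^sup>2\<close>, and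
  three times this is \<open>12 * K\<^sup>2 * p\<^sup>2\<close>.\<close>

lemma mean_kernel_bound_le:
  assumes K: "0 \<le> K"
    and mean: "\<And>a b c. a \<in> {1, 2} \<Longrightarrow> b \<in> {1, 2} \<Longrightarrow> c \<in> {1, 2} \<Longrightarrow>
      \<bar>vinner p (mu a p) (mvec p (Sig Lam c p) (mu b p)) / real p\<bar> \<le> K"
    and trace: "\<And>a. a \<in> {1, 2} \<Longrightarrow> \<bar>mtrace p (Sig Lam a p) / real p\<bar> \<le> K"
  shows "mean_kernel_bound \<le> 48 * K + 12 * K\<^sup>2"
proof -
  have P: "1 \<le> real p" using p by simp
  define v where "v a b c = (\<Sum>s<p. \<Sum>t<p. mu a p s * mu b p t * Sig Lam c p s t)" for a b c
  have v: "\<bar>v a b c\<bar> \<le> K * real p" if "a \<in> {1, 2}" "b \<in> {1, 2}" "c \<in> {1, 2}" for a b c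
  proof -
    have "vinner p (mu a p) (mvec p (Sig Lam c p) (mu b p)) = v a b c"
      by (simp add: vinner_def mvec_def v_def sum_distrib_left mult_ac)
    then show ?thesis using mean[OF that] P by (simp add: field_simps)
  qed
  have "(\<Sum>s<p. \<Sum>t<p. gap s * gap t * pooled s t)
      = (v 1 1 1 - v 1 2 1 - v 2 1 1 + v 2 2 1) + (v 1 1 2 - v 1 2 2 - v 2 1 2 + v 2 2 2)"
    unfolding v_def sum.distrib[symmetric] sum_subtractf[symmetric]
    by (intro sum.cong refl) (simp add: algebra_simps)
  also have "\<dots> \<le> 8 * (K * real p)"
    using v[of 1 1 1] v[of 1 2 1] v[of 2 1 1] v[of 2 2 1] v[of 1 1 2] v[of 1 2 2] v[of 2 1 2] v[of 2 2 2]
    by (simp add: abs_le_iff)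
  finally have D: "(\<Sum>s<p. \<Sum>t<p. gap s * gap t * pooled s t) \<le> 8 * (K * real p)" .
  \<comment> \<open>\<open>pooled\<close> is a Gram matrix, so its entries obey the Cauchy-Schwarz
    inequality; the two observations with index 0 merely supply contrasts that realize it.\<close>
  have CS: "(pooled s t)\<^sup>2 \<le> pooled s s * pooled t t" for s t
  proof -
    have ne: "(1::nat, 0::nat) \<noteq> (2, 0)" by simp
    show ?thesis
      using Cauchy_Schwarz_ineq_sum[of "contrast Lam p (1, 0) s" "contrast Lam p (1, 0) t" "cells p {(1, 0), (2, 0)}"]
      unfolding power2_eq_square[of "contrast _ _ _ _ _"] contrast_covariance[OF ne] .
  qed
  have "(\<Sum>s<p. \<Sum>t<p. (pooled s t)\<^sup>2) \<le> (\<Sum>s<p. \<Sum>t<p. pooled s s * pooled t t)"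
    by (intro sum_mono CS)
  also have "\<dots> = (mtrace p (Sig Lam 1 p) + mtrace p (Sig Lam 2 p))\<^sup>2"
    by (simp add: mtrace_def power2_eq_square sum_product flip: sum.distrib)
  also have "\<dots> \<le> (2 * (K * real p))\<^sup>2"
  proof -
    have "\<bar>mtrace p (Sig Lam a p)\<bar> \<le> K * real p" if "a \<in> {1, 2}" for a
      using trace[OF that] P by (simp add: field_simps)
    from this[of 1] this[of 2]
    have "\<bar>mtrace p (Sig Lam 1 p) + mtrace p (Sig Lam 2 p)\<bar> \<le> \<bar>2 * (K * real p)\<bar>" by simp
    then show ?thesis by (rule abs_le_square_iff[THEN iffD1])
  qed
  finally have T: "(\<Sum>s<p. \<Sum>t<p. (pooled s t)\<^sup>2) \<le> 4 * (K\<^sup>2 * (real p)\<^sup>2)"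
    by (simp add: power_mult_distrib)
  \<comment> \<open>The first part is only of order \<open>p\<close>; raising it to
    \<open>p\<^sup>2\<close> gives up a decay in \<open>p\<close> that the claim does not ask
    for.\<close>
  have KP: "K * real p \<le> K * (real p)\<^sup>2"
    using P K by (intro mult_left_mono) (auto simp: power2_eq_square)
  have "3 * (2 * (\<Sum>s<p. \<Sum>t<p. gap s * gap t * pooled s t) + (\<Sum>s<p. \<Sum>t<p. (pooled s t)\<^sup>2))
      \<le> 48 * (K * (real p)\<^sup>2) + 12 * (K\<^sup>2 * (real p)\<^sup>2)"
  proof -
    have "3 * (2 * d + e) \<le> 48 * z + 12 * y" if "x \<le> z" "d \<le> 8 * x" "e \<le> 4 * y" for d e x y z :: real
      using that by simp
    from this[OF KP D T] show ?thesis .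
  qed
  also have "\<dots> = (48 * K + 12 * K\<^sup>2) * (real p)\<^sup>2" by (simp add: algebra_simps)
  finally show ?thesis
    unfolding mean_kernel_bound_def using P by (simp add: pos_divide_le_eq)
qed

lemma E0_properties:
  assumes nm: "4 \<le> n" "4 \<le> m"
  shows "random_variable borel (E0 Lam mu Y p n m)"
    and "integrable M (\<lambda>\<omega>. (E0 Lam mu Y p n m \<omega>)\<^sup>2)"
    and "integrable M (E0 Lam mu Y p n m)"
    and "expectation (E0 Lam mu Y p n m) = mudist mu p"
    and "var M (E0 Lam mu Y p n m) \<le> mean_kernel_bound * (172 * (1 / real n + 1 / real m))"
proof -
  note ker = mean_kernel_moments[of _ n m]
  note avg = average_square_integrable[OF finite_quads paired_quads_nonempty[OF nm],
      where f = mean_kernel and K = "\<lambda>J. cells p (observations 1 2 J)", OF ker(1-4), folded E0_eq_average[OF nm]]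
  show "random_variable borel (E0 Lam mu Y p n m)" "integrable M (\<lambda>\<omega>. (E0 Lam mu Y p n m \<omega>)\<^sup>2)"
    "integrable M (E0 Lam mu Y p n m)" "expectation (E0 Lam mu Y p n m) = mudist mu p"
    using avg by (simp_all add: E0_eq_average[OF nm])
  have "\<bar>covariance M (E0 Lam mu Y p n m) (E0 Lam mu Y p n m)\<bar>
      \<le> mean_kernel_bound * (172 * (1 / real n + 1 / real m))"
    unfolding E0_eq_average[OF nm]
    by (rule abs_covariance_average_le[OF finite_quads paired_quads_nonempty[OF nm]
          finite_quads paired_quads_nonempty[OF nm] ker ker paired_quads_meeting_le[OF nm]]) simp_all
  then show "var M (E0 Lam mu Y p n m) \<le> mean_kernel_bound * (172 * (1 / real n + 1 / real m))"
    unfolding var_eq_covariance by linarith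
qed

lemma Rone_eq_average:
  assumes i: "i \<in> {1, 2}" and n: "4 \<le> ssize n1 n2 i"
  shows "Rone Lam mu Y p i n1 n2 = (\<lambda>\<omega>.
    (\<Sum>J\<in>distinct_quads (ssize n1 n2 i). trace_kernel i i J \<omega>) / real (card (distinct_quads (ssize n1 n2 i))))"
proof -
  have "\<tau> i i \<noteq> 0" "real p \<noteq> 0" using \<tau>_pos[OF i i] p by auto
  then show ?thesis
    unfolding Rone_def mtrace_mpow_2_Sig Eone_eq_average[OF i n] by simp
qed

lemma Rtwo_eq_average:
  assumes ij: "i \<in> {1, 2}" "j \<in> {1, 2}" and nm: "4 \<le> ssize n1 n2 i" "4 \<le> ssize n1 n2 j"
  shows "Rtwo Lam mu Y p i j n1 n2 = (\<lambda>\<omega>.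
    (\<Sum>J\<in>paired_quads (ssize n1 n2 i) (ssize n1 n2 j). trace_kernel i j J \<omega>)
      / real (card (paired_quads (ssize n1 n2 i) (ssize n1 n2 j))))"
proof -
  have "\<tau> i j \<noteq> 0" "real p \<noteq> 0" using \<tau>_pos[OF ij] p by auto
  then show ?thesis
    unfolding Rtwo_def Etwo_eq_average[OF ij nm] by simp
qed

lemma Rone_properties:
  assumes i: "i \<in> {1, 2}" and n: "4 \<le> ssize n1 n2 i"
  shows "random_variable borel (Rone Lam mu Y p i n1 n2)"
    and "integrable M (\<lambda>\<omega>. (Rone Lam mu Y p i n1 n2 \<omega>)\<^sup>2)"
    and "expectation (Rone Lam mu Y p i n1 n2) = 1"
    and "var M (Rone Lam mu Y p i n1 n2) \<le> (3 * \<gamma> + 4) ^ 4 * (172 / real (ssize n1 n2 i))"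
    and "integrable M (Eone Lam mu Y p i (ssize n1 n2 i))"
    and "expectation (Eone Lam mu Y p i (ssize n1 n2 i)) = mtrace p (mpow p (Sig Lam i p) 2) / (real p)\<^sup>2"
proof -
  note ker = trace_kernel_distinct_quads[OF i, of _ "ssize n1 n2 i"]
  note avg = average_square_integrable[OF finite_quads distinct_quads_nonempty[OF n],
      where f = "trace_kernel i i" and K = "\<lambda>J. cells p (observations i i J)", OF ker(1-4)]
  show "random_variable borel (Rone Lam mu Y p i n1 n2)"
    "integrable M (\<lambda>\<omega>. (Rone Lam mu Y p i n1 n2 \<omega>)\<^sup>2)" "expectation (Rone Lam mu Y p i n1 n2) = 1"
    unfolding Rone_eq_average[OF i n] by (rule avg; assumption)+
  show "integrable M (Eone Lam mu Y p i (ssize n1 n2 i))"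
    unfolding Eone_eq_average[OF i n] by (intro integrable_mult_right avg(3))
  show "expectation (Eone Lam mu Y p i (ssize n1 n2 i)) = mtrace p (mpow p (Sig Lam i p) 2) / (real p)\<^sup>2"
    unfolding Eone_eq_average[OF i n] mtrace_mpow_2_Sig
    by (subst integral_mult_right_zero, subst avg(4)) simp_all
  have "\<bar>covariance M (Rone Lam mu Y p i n1 n2) (Rone Lam mu Y p i n1 n2)\<bar>
      \<le> (3 * \<gamma> + 4) ^ 4 * (172 / real (ssize n1 n2 i))"
    unfolding Rone_eq_average[OF i n]
    by (rule abs_covariance_average_le[OF finite_quads distinct_quads_nonempty[OF n]
          finite_quads distinct_quads_nonempty[OF n] ker ker distinct_quads_meeting_le[OF n]])
  then show "var M (Rone Lam mu Y p i n1 n2) \<le> (3 * \<gamma> + 4) ^ 4 * (172 / real (ssize n1 n2 i))"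
    unfolding var_eq_covariance by linarith
qed

lemma Rtwo_properties:
  assumes ij: "i \<in> {1, 2}" "j \<in> {1, 2}" "i \<noteq> j"
    and nm: "4 \<le> ssize n1 n2 i" "4 \<le> ssize n1 n2 j"
  shows "random_variable borel (Rtwo Lam mu Y p i j n1 n2)"
    and "integrable M (\<lambda>\<omega>. (Rtwo Lam mu Y p i j n1 n2 \<omega>)\<^sup>2)"
    and "expectation (Rtwo Lam mu Y p i j n1 n2) = 1"
    and "var M (Rtwo Lam mu Y p i j n1 n2)
      \<le> (3 * \<gamma> + 4) ^ 4 * (172 * (1 / real (ssize n1 n2 i) + 1 / real (ssize n1 n2 j)))"
    and "\<bar>covariance M (Rone Lam mu Y p i n1 n2) (Rtwo Lam mu Y p i j n1 n2)\<bar>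
      \<le> (3 * \<gamma> + 4) ^ 4 * (172 / real (ssize n1 n2 i))"
    and "integrable M (Etwo Lam mu Y p i j (ssize n1 n2 i) (ssize n1 n2 j))"
    and "expectation (Etwo Lam mu Y p i j (ssize n1 n2 i) (ssize n1 n2 j))
      = mtrace p (mmult p (Sig Lam 1 p) (Sig Lam 2 p)) / (real p)\<^sup>2"
proof -
  note ker1 = trace_kernel_distinct_quads[OF ij(1), of _ "ssize n1 n2 i"]
  note ker = trace_kernel_paired_quads[OF ij, of _ "ssize n1 n2 i" "ssize n1 n2 j"]
  note avg = average_square_integrable[OF finite_quads paired_quads_nonempty[OF nm],
      where f = "trace_kernel i j" and K = "\<lambda>J. cells p (observations i j J)", OF ker(1-4)]
  show "random_variable borel (Rtwo Lam mu Y p i j n1 n2)"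
    "integrable M (\<lambda>\<omega>. (Rtwo Lam mu Y p i j n1 n2 \<omega>)\<^sup>2)" "expectation (Rtwo Lam mu Y p i j n1 n2) = 1"
    unfolding Rtwo_eq_average[OF ij(1,2) nm] by (rule avg; assumption)+
  show "integrable M (Etwo Lam mu Y p i j (ssize n1 n2 i) (ssize n1 n2 j))"
    unfolding Etwo_eq_average[OF ij(1,2) nm] by (intro integrable_mult_right avg(3))
  have "expectation (Etwo Lam mu Y p i j (ssize n1 n2 i) (ssize n1 n2 j)) = \<tau> i j / (real p)\<^sup>2"
    unfolding Etwo_eq_average[OF ij(1,2) nm]
    by (subst integral_mult_right_zero, subst avg(4)) simp_all
  \<comment> \<open>\<open>\<tau>\<close> is symmetric in its arguments, so both orders of the
    samples estimate the same quantity.\<close>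
  also have "\<tau> i j = \<tau> 1 2"
    using ij unfolding mtrace_mmult_Sig by (auto simp: mult.commute)
  finally show "expectation (Etwo Lam mu Y p i j (ssize n1 n2 i) (ssize n1 n2 j)) = \<tau> 1 2 / (real p)\<^sup>2" .
  have "\<bar>covariance M (Rtwo Lam mu Y p i j n1 n2) (Rtwo Lam mu Y p i j n1 n2)\<bar>
      \<le> (3 * \<gamma> + 4) ^ 4 * (172 * (1 / real (ssize n1 n2 i) + 1 / real (ssize n1 n2 j)))"
    unfolding Rtwo_eq_average[OF ij(1,2) nm]
    by (rule abs_covariance_average_le[OF finite_quads paired_quads_nonempty[OF nm]
          finite_quads paired_quads_nonempty[OF nm] ker ker paired_quads_meeting_le[OF nm ij(3)]])
  then show "var M (Rtwo Lam mu Y p i j n1 n2)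
      \<le> (3 * \<gamma> + 4) ^ 4 * (172 * (1 / real (ssize n1 n2 i) + 1 / real (ssize n1 n2 j)))"
    unfolding var_eq_covariance by linarith
  show "\<bar>covariance M (Rone Lam mu Y p i n1 n2) (Rtwo Lam mu Y p i j n1 n2)\<bar>
      \<le> (3 * \<gamma> + 4) ^ 4 * (172 / real (ssize n1 n2 i))"
    unfolding Rone_eq_average[OF ij(1) nm(1)] Rtwo_eq_average[OF ij(1,2) nm]
    by (rule abs_covariance_average_le[OF finite_quads distinct_quads_nonempty[OF nm(1)]
          finite_quads paired_quads_nonempty[OF nm] ker1 ker distinct_paired_quads_meeting_le[OF nm ij(3)]])
qed

end

section \<open>Uniform constants and convergence of the ratios\<close>

theorem theorem2p2:
  fixes M :: "'a measure"
    and Lam :: "nat \<Rightarrow> nat \<Rightarrow> nat \<Rightarrow> nat \<Rightarrow> real"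
    and mu :: "nat \<Rightarrow> nat \<Rightarrow> nat \<Rightarrow> real"
    and Y :: "nat \<Rightarrow> nat \<Rightarrow> nat \<Rightarrow> nat \<Rightarrow> 'a \<Rightarrow> real"
    and gam :: real
    and i j :: nat
  assumes M: "prob_space M"
    and ij: "i \<in> {1, 2}" "j \<in> {1, 2}" "i \<noteq> j"
    and indep: "\<forall>p\<ge>1. prob_space.indep_vars M (\<lambda>_. borel) (\<lambda>(a, k, s). Y p a k s)
                     {(a, k, s). a \<in> {1, 2::nat} \<and> s < p}"
    and ident: "\<forall>p\<ge>1. \<forall>a\<in>{1, 2}. \<forall>k s. s < p \<longrightarrow>
                     distr M borel (Y p a k s) = distr M borel (Y p a 0 0)"
    and moments: "\<forall>p\<ge>1. \<forall>a\<in>{1, 2}. \<forall>k s. s < p \<longrightarrow>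
                     integrable M (\<lambda>\<omega>. (Y p a k s \<omega>) ^ 4) \<and>
                     integral\<^sup>L M (Y p a k s) = 0 \<and>
                     integral\<^sup>L M (\<lambda>\<omega>. (Y p a k s \<omega>)\<^sup>2) = 1 \<and>
                     integral\<^sup>L M (\<lambda>\<omega>. (Y p a k s \<omega>) ^ 4) = gam"
    and posdef: "\<forall>p\<ge>1. \<forall>a\<in>{1, 2}. pos_def p (Sig Lam a p)"
    and A2: "\<forall>a\<in>{1, 2}. (\<lambda>p. mtrace p (Sig Lam a p) / real p) \<in> O(\<lambda>p. 1)"
    and A3: "\<forall>a\<in>{1, 2}. \<forall>b\<in>{1, 2}. \<forall>c\<in>{1, 2}.
               (\<lambda>p. vinner p (mu a p) (mvec p (Sig Lam c p) (mu b p)) / real p) \<in> O(\<lambda>p. 1)"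
    and A4: "\<forall>a\<in>{1, 2, 3}. \<forall>b\<in>{1, 2, 3}. a + b \<le> 4 \<longrightarrow>
               (\<forall>c\<in>{1, 2}. \<forall>d\<in>{1, 2}.
                 ((\<lambda>p. mtrace p (hadamard (mpow p (Sig Lam c p) a) (mpow p (Sig Lam d p) b))
                       / mtrace (p * p) (kron p (mpow p (Sig Lam c p) a) (mpow p (Sig Lam d p) b)))
                  \<longlongrightarrow> 0) sequentially)"
  shows "(\<forall>p\<ge>1. \<forall>n1\<ge>4. \<forall>n2\<ge>4.
            integrable M (E0 Lam mu Y p n1 n2) \<and>
            integral\<^sup>L M (E0 Lam mu Y p n1 n2) = mudist mu p \<and>
            integrable M (Eone Lam mu Y p i (ssize n1 n2 i)) \<and>
            integral\<^sup>L M (Eone Lam mu Y p i (ssize n1 n2 i))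
              = mtrace p (mpow p (Sig Lam i p) 2) / (real p)\<^sup>2 \<and>
            integrable M (Etwo Lam mu Y p i j (ssize n1 n2 i) (ssize n1 n2 j)) \<and>
            integral\<^sup>L M (Etwo Lam mu Y p i j (ssize n1 n2 i) (ssize n1 n2 j))
              = mtrace p (mmult p (Sig Lam 1 p) (Sig Lam 2 p)) / (real p)\<^sup>2)
     \<and> ((\<exists>c>0. \<forall>p\<ge>1. c \<le> mudist mu p) \<longrightarrow>
         (\<exists>C. \<forall>p\<ge>1. \<forall>n1\<ge>4. \<forall>n2\<ge>4.
            integrable M (\<lambda>\<omega>. (R0 Lam mu Y p n1 n2 \<omega>)\<^sup>2) \<and>
            integrable M (\<lambda>\<omega>. (Rone Lam mu Y p i n1 n2 \<omega>)\<^sup>2) \<and>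
            integrable M (\<lambda>\<omega>. (Rtwo Lam mu Y p i j n1 n2 \<omega>)\<^sup>2) \<and>
            var M (R0 Lam mu Y p n1 n2)
              \<le> C * (1 / real (ssize n1 n2 i) + 1 / real (ssize n1 n2 j)) \<and>
            var M (Rone Lam mu Y p i n1 n2) \<le> C * (1 / real (ssize n1 n2 i)) \<and>
            var M (Rtwo Lam mu Y p i j n1 n2)
              \<le> C * (1 / real (ssize n1 n2 i) + 1 / real (ssize n1 n2 j)) \<and>
            \<bar>covariance M (Rone Lam mu Y p i n1 n2) (Rtwo Lam mu Y p i j n1 n2)\<bar>
              \<le> C * (1 / real (ssize n1 n2 i)))
         \<and> (\<forall>N1 N2 P :: nat \<Rightarrow> nat.
              filterlim N1 at_top sequentially \<longrightarrow> filterlim N2 at_top sequentially \<longrightarrow>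
              (\<forall>m. 1 \<le> P m) \<longrightarrow>
              (\<forall>e>0.
                 ((\<lambda>m. measure M {\<omega> \<in> space M. \<bar>R0 Lam mu Y (P m) (N1 m) (N2 m) \<omega> - 1\<bar> > e})
                    \<longlongrightarrow> 0) sequentially \<and>
                 ((\<lambda>m. measure M {\<omega> \<in> space M. \<bar>Rone Lam mu Y (P m) i (N1 m) (N2 m) \<omega> - 1\<bar> > e})
                    \<longlongrightarrow> 0) sequentially \<and>
                 ((\<lambda>m. measure M {\<omega> \<in> space M. \<bar>Rtwo Lam mu Y (P m) i j (N1 m) (N2 m) \<omega> - 1\<bar> > e})
                    \<longlongrightarrow> 0) sequentially)))"
proof -
  interpret prob_space M by (rule M)
  have model: "two_sample_model M Y p gam Lam" if "1 \<le> p" for p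
    using indep moments posdef that
    by (intro two_sample_model.intro standardized_family.intro standardized_family_axioms.intro
        two_sample_model_axioms.intro prob_space_axioms) auto
  note E0_props = two_sample_model.E0_properties[OF model, where mu = mu]
    and Rone_props = two_sample_model.Rone_properties[OF model ij(1), where mu = mu]
    and Rtwo_props = two_sample_model.Rtwo_properties[OF model ij, where mu = mu]
  have sizes: "4 \<le> ssize n1 n2 i" "4 \<le> ssize n1 n2 j" if "4 \<le> n1" "4 \<le> n2" for n1 n2
    using that by (simp_all add: ssize_def)
  \<comment> \<open>\<open>E0\<close> treats sample 1 first, while the claim is phrased in
    \<open>i\<close> and \<open>j\<close>; the sum of reciprocals is the same for either
    labelling.\<close>
  have size_sum: "1 / real (ssize n1 n2 i) + 1 / real (ssize n1 n2 j) = 1 / real n1 + 1 / real n2" for n1 n2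
    using ij by (auto simp: ssize_def)
  \<comment> \<open>The eight forms of Assumption 3 are indexed by triples so that one constant
    serves all of them.\<close>
  have "\<exists>K. \<forall>x\<in>{1, 2} \<times> {1, 2} \<times> {1, 2}. \<forall>p. \<bar>(case x of (a, b, c) \<Rightarrow>
      \<lambda>p. vinner p (mu a p) (mvec p (Sig Lam c p) (mu b p)) / real p) p\<bar> \<le> K"
    using A3 by (intro finite_family_bigo_one_imp_bounded) auto
  then obtain K1 where "\<forall>x\<in>{1, 2} \<times> {1, 2} \<times> {1, 2}. \<forall>p. \<bar>(case x of (a, b, c) \<Rightarrow>
      \<lambda>p. vinner p (mu a p) (mvec p (Sig Lam c p) (mu b p)) / real p) p\<bar> \<le> K1" ..
  from bspec[OF this, of "(a, b, c)" for a b c]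
  have K1: "\<bar>vinner p (mu a p) (mvec p (Sig Lam c p) (mu b p)) / real p\<bar> \<le> K1"
    if "a \<in> {1, 2}" "b \<in> {1, 2}" "c \<in> {1, 2}" for a b c p
    unfolding prod.case using that by blast
  have "\<exists>K. \<forall>a\<in>{1, 2}. \<forall>p. \<bar>mtrace p (Sig Lam a p) / real p\<bar> \<le> K"
    using A2 by (intro finite_family_bigo_one_imp_bounded) auto
  then obtain K2 where "\<forall>a\<in>{1, 2}. \<forall>p. \<bar>mtrace p (Sig Lam a p) / real p\<bar> \<le> K2" ..
  then have K2: "\<bar>mtrace p (Sig Lam a p) / real p\<bar> \<le> K2" if "a \<in> {1, 2}" for a p
    using that by blast
  define K where "K = \<bar>K1\<bar> + \<bar>K2\<bar>"
  have K: "0 \<le> K" "K1 \<le> K" "K2 \<le> K" by (simp_all add: K_def)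
  have mean_bound: "two_sample_model.mean_kernel_bound p Lam mu \<le> 48 * K + 12 * K\<^sup>2" if "1 \<le> p" for p
    by (rule two_sample_model.mean_kernel_bound_le[OF model[OF that] K(1)])
      (rule order_trans[OF K1 K(2)] order_trans[OF K2 K(3)]; assumption)+
  show ?thesis
  proof (rule conjI, goal_cases)
    case 1
    show ?case by (intro allI impI conjI E0_props Rone_props Rtwo_props sizes)
  next
    case 2
    show ?case
    proof (rule impI, goal_cases)
      case 1
      then obtain c where c: "0 < c" "\<And>p. 1 \<le> p \<Longrightarrow> c \<le> mudist mu p" by blast
      \<comment> \<open>One constant for all ratios: the first summand serves the trace ratios, the
        second serves \<open>R0\<close>, where \<open>c\<^sup>2\<close> comes from dividing the
        variance by the square of \<open>mudist mu p\<close>.\<close>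
      define V where "V = (3 * gam + 4) ^ 4 + (48 * K + 12 * K\<^sup>2) / c\<^sup>2"
      define C where "C = 172 * V"
      have V: "(3 * gam + 4) ^ 4 \<le> V" "(48 * K + 12 * K\<^sup>2) / c\<^sup>2 \<le> V" "0 \<le> V"
        using K(1) by (simp_all add: V_def zero_le_even_power)
      have R0: "random_variable borel (R0 Lam mu Y p n1 n2) \<and> integrable M (\<lambda>\<omega>. (R0 Lam mu Y p n1 n2 \<omega>)\<^sup>2)
          \<and> expectation (R0 Lam mu Y p n1 n2) = 1
          \<and> var M (R0 Lam mu Y p n1 n2) \<le> C * (1 / real (ssize n1 n2 i) + 1 / real (ssize n1 n2 j))"
        if p: "1 \<le> p" and n: "4 \<le> n1" "4 \<le> n2" for p n1 n2
      proof -
        have \<delta>: "0 < mudist mu p" "c\<^sup>2 \<le> (mudist mu p)\<^sup>2" using c(1) c(2)[OF p] by (auto intro: power_mono)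
        have R0_eq: "R0 Lam mu Y p n1 n2 = (\<lambda>\<omega>. E0 Lam mu Y p n1 n2 \<omega> / mudist mu p)"
          by (simp add: fun_eq_iff R0_def)
        have "var M (R0 Lam mu Y p n1 n2) = var M (E0 Lam mu Y p n1 n2) / (mudist mu p)\<^sup>2"
          unfolding R0_eq by (rule var_divide)
        also have "\<dots> \<le> ((48 * K + 12 * K\<^sup>2) * (172 * (1 / real n1 + 1 / real n2))) / (mudist mu p)\<^sup>2"
          by (intro divide_right_mono order_trans[OF E0_props(5)[OF p n]] mult_right_mono mean_bound p) simp_all
        also have "\<dots> \<le> ((48 * K + 12 * K\<^sup>2) * (172 * (1 / real n1 + 1 / real n2))) / c\<^sup>2"
          using \<delta> c(1) K(1) by (intro divide_left_mono mult_nonneg_nonneg mult_pos_pos) auto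
        also have "\<dots> = ((48 * K + 12 * K\<^sup>2) / c\<^sup>2) * (172 * (1 / real n1 + 1 / real n2))" by simp
        also have "\<dots> \<le> V * (172 * (1 / real n1 + 1 / real n2))"
          using V by (intro mult_right_mono) auto
        also have "\<dots> = C * (1 / real (ssize n1 n2 i) + 1 / real (ssize n1 n2 j))"
          unfolding size_sum C_def by simp
        finally have "var M (R0 Lam mu Y p n1 n2) \<le> C * (1 / real (ssize n1 n2 i) + 1 / real (ssize n1 n2 j))" .
        then show ?thesis
          using E0_props(1-4)[OF p n] \<delta>(1) unfolding R0_eq by (simp add: power_divide)
      qed
      have Rone: "random_variable borel (Rone Lam mu Y p i n1 n2) \<and> integrable M (\<lambda>\<omega>. (Rone Lam mu Y p i n1 n2 \<omega>)\<^sup>2)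
          \<and> expectation (Rone Lam mu Y p i n1 n2) = 1
          \<and> var M (Rone Lam mu Y p i n1 n2) \<le> C * (1 / real (ssize n1 n2 i))"
        if p: "1 \<le> p" and n: "4 \<le> n1" "4 \<le> n2" for p n1 n2
      proof -
        have "(3 * gam + 4) ^ 4 * (172 / real (ssize n1 n2 i)) \<le> V * (172 / real (ssize n1 n2 i))"
          using V by (intro mult_right_mono) auto
        also have "\<dots> = C * (1 / real (ssize n1 n2 i))" by (simp add: C_def)
        finally show ?thesis using Rone_props(1-4)[OF p sizes(1)[OF n]] by linarith
      qed
      have Rtwo: "random_variable borel (Rtwo Lam mu Y p i j n1 n2) \<and> integrable M (\<lambda>\<omega>. (Rtwo Lam mu Y p i j n1 n2 \<omega>)\<^sup>2)
          \<and> expectation (Rtwo Lam mu Y p i j n1 n2) = 1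
          \<and> var M (Rtwo Lam mu Y p i j n1 n2) \<le> C * (1 / real (ssize n1 n2 i) + 1 / real (ssize n1 n2 j))
          \<and> \<bar>covariance M (Rone Lam mu Y p i n1 n2) (Rtwo Lam mu Y p i j n1 n2)\<bar> \<le> C * (1 / real (ssize n1 n2 i))"
        if p: "1 \<le> p" and n: "4 \<le> n1" "4 \<le> n2" for p n1 n2
      proof -
        let ?s = "1 / real (ssize n1 n2 i) + 1 / real (ssize n1 n2 j)"
        have "(3 * gam + 4) ^ 4 * (172 / real (ssize n1 n2 i)) \<le> V * (172 / real (ssize n1 n2 i))"
          "(3 * gam + 4) ^ 4 * (172 * ?s) \<le> V * (172 * ?s)"
          using V by (intro mult_right_mono; simp)+
        moreover have "V * (172 / real (ssize n1 n2 i)) = C * (1 / real (ssize n1 n2 i))"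
          "V * (172 * ?s) = C * ?s" by (simp_all add: C_def)
        ultimately show ?thesis
          using Rtwo_props(1-5)[OF p sizes[OF n]] by linarith
      qed
      \<comment> \<open>\<open>P\<close> is an arbitrary sequence of dimensions, so constant and
        growing ones are covered alike: the bounds are uniform in \<open>p\<close>, and the sample
        sizes alone drive the variances to zero.\<close>
      have conv: "(\<forall>e>0.
            ((\<lambda>m. measure M {\<omega> \<in> space M. \<bar>R0 Lam mu Y (P m) (N1 m) (N2 m) \<omega> - 1\<bar> > e}) \<longlongrightarrow> 0) sequentially \<and>
            ((\<lambda>m. measure M {\<omega> \<in> space M. \<bar>Rone Lam mu Y (P m) i (N1 m) (N2 m) \<omega> - 1\<bar> > e}) \<longlongrightarrow> 0) sequentially \<and>
            ((\<lambda>m. measure M {\<omega> \<in> space M. \<bar>Rtwo Lam mu Y (P m) i j (N1 m) (N2 m) \<omega> - 1\<bar> > e}) \<longlongrightarrow> 0) sequentially)"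
        if N: "filterlim N1 at_top sequentially" "filterlim N2 at_top sequentially" and P: "\<forall>m. 1 \<le> P m"
        for N1 N2 P :: "nat \<Rightarrow> nat"
      proof -
        \<comment> \<open>A common bound for the three variances; the one for \<open>Rone\<close>
          lacks the second reciprocal and is enlarged in \<open>b1\<close>.\<close>
        define b where "b m = C * (1 / real (N1 m) + 1 / real (N2 m))" for m
        have inv: "(\<lambda>m. 1 / real (N m)) \<longlonglongrightarrow> 0" if "filterlim N at_top sequentially" for N
          using filterlim_compose[OF lim_1_over_n that] by simp
        have b: "b \<longlonglongrightarrow> 0"
          unfolding b_def using tendsto_mult[OF tendsto_const[of C] tendsto_add[OF inv[OF N(1)] inv[OF N(2)]]] by simp
        have ev: "eventually (\<lambda>m. 4 \<le> N1 m \<and> 4 \<le> N2 m) sequentially"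
          using N unfolding filterlim_at_top by (intro eventually_conj) blast+
        have "0 \<le> C" using V(3) by (simp add: C_def)
        have b1: "C * (1 / real (ssize (N1 m) (N2 m) i)) \<le> b m" for m
          unfolding b_def size_sum[symmetric, of "N1 m" "N2 m"]
          by (rule mult_left_mono[OF _ \<open>0 \<le> C\<close>]) simp
        show ?thesis
        proof (intro allI impI conjI; rule deviation_tendsto_zero[OF _ b])
          show "eventually (\<lambda>m. random_variable borel (R0 Lam mu Y (P m) (N1 m) (N2 m))
              \<and> integrable M (\<lambda>\<omega>. (R0 Lam mu Y (P m) (N1 m) (N2 m) \<omega>)\<^sup>2)
              \<and> expectation (R0 Lam mu Y (P m) (N1 m) (N2 m)) = 1
              \<and> var M (R0 Lam mu Y (P m) (N1 m) (N2 m)) \<le> b m) sequentially"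
            using ev
          proof eventually_elim
            case (elim m)
            show ?case
              using R0[OF P[rule_format] conjunct1[OF elim] conjunct2[OF elim]] unfolding b_def size_sum by blast
          qed
          show "eventually (\<lambda>m. random_variable borel (Rone Lam mu Y (P m) i (N1 m) (N2 m))
              \<and> integrable M (\<lambda>\<omega>. (Rone Lam mu Y (P m) i (N1 m) (N2 m) \<omega>)\<^sup>2)
              \<and> expectation (Rone Lam mu Y (P m) i (N1 m) (N2 m)) = 1
              \<and> var M (Rone Lam mu Y (P m) i (N1 m) (N2 m)) \<le> b m) sequentially"
            using ev
          proof eventually_elim
            case (elim m)
            show ?case
              using Rone[OF P[rule_format] conjunct1[OF elim] conjunct2[OF elim]] b1[of m]
              by (blast intro: order_trans)
          qed
          show "eventually (\<lambda>m. random_variable borel (Rtwo Lam mu Y (P m) i j (N1 m) (N2 m))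
              \<and> integrable M (\<lambda>\<omega>. (Rtwo Lam mu Y (P m) i j (N1 m) (N2 m) \<omega>)\<^sup>2)
              \<and> expectation (Rtwo Lam mu Y (P m) i j (N1 m) (N2 m)) = 1
              \<and> var M (Rtwo Lam mu Y (P m) i j (N1 m) (N2 m)) \<le> b m) sequentially"
            using ev
          proof eventually_elim
            case (elim m)
            show ?case
              using Rtwo[OF P[rule_format] conjunct1[OF elim] conjunct2[OF elim]] unfolding b_def size_sum by blast
          qed
        qed
      qed
      show ?case
      proof (rule conjI, goal_cases)
        case 1
        show ?case by (rule exI[of _ C]) (intro allI impI, use R0 Rone Rtwo in blast)
      next
        case 2
        show ?case by ((rule allI)+, (rule impI)+, rule conv)
      qed
    qed
  qed
qed

end
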